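(* Let $\mu_1,\mu_2$ be Borel probability measures on the unit circle $\mathbb{T}$, neither of which is a point mass, and let $\mu=\mu_1\boxtimes\mu_2$ be their free multiplicative convolution. Then: (1) The singular continuous part of $\mu$ relative to the arclength measure on $\mathbb{T}$ is zero. (2) If $$\max\{\mu_1(\{\alpha_1\})+\mu_2(\{\alpha_2\}) : \alpha_1,\alpha_2\in\mathbb{T}\}\le 1,$$ then $\mu$ is absolutely continuous relative to the arclength measure. (3) If $$\max\{\mu_1(\{\alpha_1\})+\mu_2(\{\alpha_2\}) : \alpha_1,\alpha_2\in\mathbb{T}\}< 1,$$ then the density of $\mu$ relative to the arclength measure is bounded.
   Context: $\mathbb{T}=\{z\in\mathbb{C}:|z|=1\}$. The free multiplicative convolution $\mu_1\boxtimes\mu_2$ of Borel probability measures $\mu_1,\mu_2$ on $\mathbb{T}$ is the distribution of $u_1u_2$, where $u_1,u_2$ are $*$-free unitary elements of a $C^*$-probability space $(\mathcal{A},\tau)$ with $\tau$ a faithful tracial state, and $u_j$ has distribution $\mu_j$, that is, $\tau(u_j^n)=\int_{\mathbb{T}}t^n\,d\mu_j(t)$ for all $n\in\mathbb{N}$. Thus $\mu_1\boxtimes\mu_2$ is the unique Borel probability measure $\mu$ on $\mathbb{T}$ with $\int_{\mathbb{T}}t^n\,d\mu(t)=\tau((u_1u_2)^n)$ for all $n\in\mathbb{N}$. The singular continuous part of $\mu$ is the atomless part of the singular summand in the Lebesgue decomposition of $\mu$ relative to arclength measure. *)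

theory Defs
  imports "HOL-Probability.Probability"
begin

section \<open>Unital C*-algebras and tracial states\<close>

(* The inherited axiom norm 1 = 1 excludes only the zero algebra, which carries no state. *)
class cstar_algebra = real_normed_algebra_1 + banach +
  fixes scaleC :: "complex \<Rightarrow> 'a \<Rightarrow> 'a"
    and adj :: "'a \<Rightarrow> 'a"
  assumes scaleR_scaleC: "scaleR r x = scaleC (complex_of_real r) x"
    and scaleC_add_right: "scaleC a (x + y) = scaleC a x + scaleC a y"
    and scaleC_add_left: "scaleC (a + b) x = scaleC a x + scaleC b x"
    and scaleC_scaleC: "scaleC a (scaleC b x) = scaleC (a * b) x"
    and mult_scaleC_left: "scaleC a x * y = scaleC a (x * y)"
    and mult_scaleC_right: "x * scaleC a y = scaleC a (x * y)"
    and norm_scaleC: "norm (scaleC a x) = cmod a * norm x"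
    and adj_adj: "adj (adj x) = x"
    and adj_add: "adj (x + y) = adj x + adj y"
    and adj_scaleC: "adj (scaleC a x) = scaleC (cnj a) (adj x)"
    and adj_mult: "adj (x * y) = adj y * adj x"
    and cstar_identity: "norm (adj x * x) = (norm x)\<^sup>2"

definition unitary :: "'a::cstar_algebra \<Rightarrow> bool" where
  "unitary u \<longleftrightarrow> adj u * u = 1 \<and> u * adj u = 1"

definition faithful_tracial_state :: "('a::cstar_algebra \<Rightarrow> complex) \<Rightarrow> bool" where
  "faithful_tracial_state \<tau> \<longleftrightarrow>
     (\<forall>x y. \<tau> (x + y) = \<tau> x + \<tau> y) \<and>
     (\<forall>a x. \<tau> (scaleC a x) = a * \<tau> x) \<and>
     (\<forall>x. \<tau> (adj x * x) \<in> \<real>\<^sub>\<ge>\<^sub>0) \<and>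
     \<tau> 1 = 1 \<and>
     (\<forall>x y. \<tau> (x * y) = \<tau> (y * x)) \<and>
     (\<forall>x. \<tau> (adj x * x) = 0 \<longrightarrow> x = 0)"

section \<open>Freeness\<close>

inductive_set star_algebra_gen :: "'a::cstar_algebra \<Rightarrow> 'a set" for u :: 'a where
  gen: "u \<in> star_algebra_gen u"
| one: "1 \<in> star_algebra_gen u"
| add: "x \<in> star_algebra_gen u \<Longrightarrow> y \<in> star_algebra_gen u \<Longrightarrow> x + y \<in> star_algebra_gen u"
| mult: "x \<in> star_algebra_gen u \<Longrightarrow> y \<in> star_algebra_gen u \<Longrightarrow> x * y \<in> star_algebra_gen u"
| scaleC: "x \<in> star_algebra_gen u \<Longrightarrow> scaleC a x \<in> star_algebra_gen u"
| adj: "x \<in> star_algebra_gen u \<Longrightarrow> adj x \<in> star_algebra_gen u"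

(* A word is a list of pairs (i, a) with a in B i; it is alternating when neighbouring
   indices differ. *)
definition free_family ::
  "('a::cstar_algebra \<Rightarrow> complex) \<Rightarrow> 'i set \<Rightarrow> ('i \<Rightarrow> 'a set) \<Rightarrow> bool" where
  "free_family \<tau> I B \<longleftrightarrow>
     (\<forall>w. w \<noteq> [] \<longrightarrow> distinct_adj (map fst w) \<longrightarrow>
          (\<forall>(i, a) \<in> set w. i \<in> I \<and> a \<in> B i \<and> \<tau> a = 0) \<longrightarrow>
          \<tau> (prod_list (map snd w)) = 0)"

definition star_free :: "('a::cstar_algebra \<Rightarrow> complex) \<Rightarrow> 'a \<Rightarrow> 'a \<Rightarrow> bool" where
  "star_free \<tau> u v \<longleftrightarrow>
     free_family \<tau> UNIV (\<lambda>b. star_algebra_gen (if b then u else v))"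

section \<open>Measures on the unit circle\<close>

abbreviation unit_circle :: "complex set" where
  "unit_circle \<equiv> sphere 0 1"

abbreviation circle_borel :: "complex measure" where
  "circle_borel \<equiv> restrict_space borel unit_circle"

definition circle_prob :: "complex measure \<Rightarrow> bool" where
  "circle_prob \<mu> \<longleftrightarrow> prob_space \<mu> \<and> sets \<mu> = sets circle_borel"

definition point_mass :: "complex measure \<Rightarrow> bool" where
  "point_mass \<mu> \<longleftrightarrow> (\<exists>\<alpha>\<in>unit_circle. \<mu> = return circle_borel \<alpha>)"

definition arclength :: "complex measure" where
  "arclength = distr (restrict_space lborel {0..<2 * pi}) circle_borel cis"

(* The maximum is attained for finite measures: for every e > 0 only finitely many atoms have
   mass at least e. *)
definition max_atom_sum :: "complex measure \<Rightarrow> complex measure \<Rightarrow> real" where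
  "max_atom_sum \<mu>\<^sub>1 \<mu>\<^sub>2 =
     (GREATEST s. \<exists>\<alpha>\<^sub>1\<in>unit_circle. \<exists>\<alpha>\<^sub>2\<in>unit_circle.
        s = measure \<mu>\<^sub>1 {\<alpha>\<^sub>1} + measure \<mu>\<^sub>2 {\<alpha>\<^sub>2})"

section \<open>Free multiplicative convolution\<close>

definition has_distribution ::
  "('a::cstar_algebra \<Rightarrow> complex) \<Rightarrow> 'a \<Rightarrow> complex measure \<Rightarrow> bool" where
  "has_distribution \<tau> u \<mu> \<longleftrightarrow>
     circle_prob \<mu> \<and> (\<forall>n::nat. \<tau> (u ^ n) = (\<integral>t. t ^ n \<partial>\<mu>))"

(* The type argument names the C*-algebra in which the two free unitaries live; by uniqueness of
   the convolution, the measure obtained does not depend on it. *)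
definition is_free_mult_convolution ::
  "'a::cstar_algebra itself \<Rightarrow> complex measure \<Rightarrow> complex measure \<Rightarrow> complex measure \<Rightarrow> bool"
  where
  "is_free_mult_convolution _ \<mu>\<^sub>1 \<mu>\<^sub>2 \<mu> \<longleftrightarrow>
     (\<exists>(\<tau> :: 'a \<Rightarrow> complex) u\<^sub>1 u\<^sub>2.
        faithful_tracial_state \<tau> \<and> unitary u\<^sub>1 \<and> unitary u\<^sub>2 \<and> star_free \<tau> u\<^sub>1 u\<^sub>2 \<and>
        has_distribution \<tau> u\<^sub>1 \<mu>\<^sub>1 \<and> has_distribution \<tau> u\<^sub>2 \<mu>\<^sub>2 \<and>
        has_distribution \<tau> (u\<^sub>1 * u\<^sub>2) \<mu>)"

section \<open>Lebesgue decomposition\<close>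

definition mutually_singular :: "'a measure \<Rightarrow> 'a measure \<Rightarrow> bool" where
  "mutually_singular N M \<longleftrightarrow>
     sets M = sets N \<and> (\<exists>S\<in>sets N. emeasure N S = 0 \<and> emeasure M (space N - S) = 0)"

definition lebesgue_decomposition ::
  "'a measure \<Rightarrow> 'a measure \<Rightarrow> 'a measure \<Rightarrow> 'a measure \<Rightarrow> bool" where
  "lebesgue_decomposition N M M\<^sub>a M\<^sub>s \<longleftrightarrow>
     sets M\<^sub>a = sets M \<and> sets M\<^sub>s = sets M \<and>
     (\<forall>A\<in>sets M. emeasure M A = emeasure M\<^sub>a A + emeasure M\<^sub>s A) \<and>
     absolutely_continuous N M\<^sub>a \<and> mutually_singular N M\<^sub>s"

definition singular_part :: "'a measure \<Rightarrow> 'a measure \<Rightarrow> 'a measure" where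
  "singular_part N M = (THE M\<^sub>s. \<exists>M\<^sub>a. lebesgue_decomposition N M M\<^sub>a M\<^sub>s)"

definition atomless_part :: "'a measure \<Rightarrow> 'a measure" where
  "atomless_part M = density M (indicator {x \<in> space M. emeasure M {x} = 0})"

definition singular_continuous_part :: "'a measure \<Rightarrow> 'a measure \<Rightarrow> 'a measure" where
  "singular_continuous_part N M = atomless_part (singular_part N M)"

end

theory Submission
  imports Defs "HOL-Complex_Analysis.Complex_Analysis"
begin

text \<open>
  Let \<open>G\<close> be the moment generating function \<open>\<integral> 1 / (1 - t z) d\<mu>(t)\<close> of the convolution, \<open>G1\<close> and \<open>G2\<close> those of
  its factors. Everything follows from the behaviour of \<open>G\<close> at the points of the circle where it is
  unbounded.

  Freeness enters through subordination: there are self-maps \<open>\<omega>1\<close>, \<open>\<omega>2\<close> of the disc with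
  \<open>G z = G1 (\<omega>1 z) = G2 (\<omega>2 z)\<close> and \<open>\<omega>1 z * \<omega>2 z = z * (1 - 1 / G z)\<close>. They arise as fixed points
  (\<open>holomorphic_fixed_point\<close>), and the resolvent of the product of the two unitaries is, up to the
  resolvents of its factors, a Neumann series in free centred elements; its trace is therefore explicit
  (theorem \<open>subordination\<close>).

  For a law \<open>\<mu>\<close> with transform \<open>G\<close> let \<open>Q(w)\<close> be the quotient of \<open>(norm (G w))\<^sup>2\<close> by
  \<open>\<integral> 1 / (norm (1 - t w))\<^sup>2 d\<mu>(t)\<close>, called concentration below. The Poisson kernel identity makes
  \<open>1 - (norm w)\<^sup>2\<close> equal to \<open>Q(w)\<close> times a quantity that depends on \<open>G w\<close> alone. Inserting this into the
  product relation for \<open>\<omega>1\<close> and \<open>\<omega>2\<close> gives the inequality \<open>concentration_le\<close>,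
  \<open>Q(z) \<le> Q1(\<omega>1 z) + Q2(\<omega>2 z) - (norm z)\<^sup>2\<close>. If \<open>G\<close> blows up along a sequence, then \<open>z\<close>, \<open>\<omega>1 z\<close> and
  \<open>\<omega>2 z\<close> accumulate at points \<open>\<xi>1 \<xi>2\<close>, \<open>\<xi>1\<close> and \<open>\<xi>2\<close> of the circle, and by Cauchy--Schwarz
  (\<open>concentration_at_singularity\<close>) the two terms on the right are in the limit at most the masses \<open>m1\<close> and
  \<open>m2\<close> of the atoms at the conjugates of \<open>\<xi>1\<close> and \<open>\<xi>2\<close>. Hence \<open>0 < Q(z) \<le> m1 + m2 - 1 + o(1)\<close> along the
  sequence (\<open>singularity\<close>).

  The three claims are consequences. If all sums of atoms are below 1, then \<open>G\<close> is bounded, so the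
  Poisson integral is bounded, and comparison of balls with arcs gives a bounded density. In general
  \<open>m1 + m2 \<ge> 1\<close> leaves only finitely many points \<open>\<xi>1 \<xi>2\<close>, since neither factor is a point mass. Off the
  conjugates of these points the convolution is absolutely continuous, hence its singular part lives on a
  finite set and is atomic. Finally, an atom keeps \<open>Q\<close> away from 0 along its radius, so it requires
  \<open>m1 + m2 > 1\<close>.
\<close>

section \<open>Traces on a C*-algebra\<close>

lemma scaleC_one [simp]: "scaleC 1 (x::'a::cstar_algebra) = x"
  using scaleR_scaleC[of 1 x] by simp

lemma scaleC_zero_left [simp]: "scaleC 0 (x::'a::cstar_algebra) = 0"
  using scaleR_scaleC[of 0 x] by simp

lemma scaleC_zero_right [simp]: "scaleC a (0::'a::cstar_algebra) = 0"
  using scaleC_add_right[of a 0 "0::'a"] by simp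

lemma scaleC_minus_right: "scaleC a (- x) = - scaleC a (x::'a::cstar_algebra)"
  using scaleC_add_right[of a x "-x"] by (simp add: eq_neg_iff_add_eq_0 add.commute)

lemma scaleC_minus_left: "scaleC (- a) x = - scaleC a (x::'a::cstar_algebra)"
  using scaleC_add_left[of a "-a" x] by (simp add: eq_neg_iff_add_eq_0 add.commute)

lemma scaleC_diff_right: "scaleC a (x - y) = scaleC a x - scaleC a (y::'a::cstar_algebra)"
  using scaleC_add_right[of a x "-y"] by (simp add: scaleC_minus_right)

lemma scaleC_diff_left: "scaleC (a - b) x = scaleC a x - scaleC b (x::'a::cstar_algebra)"
  using scaleC_add_left[of a "-b" x] by (simp add: scaleC_minus_left)

lemma power_scaleC: "(scaleC a x) ^ n = scaleC (a ^ n) ((x::'a::cstar_algebra) ^ n)"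
  by (induction n) (simp_all add: mult_scaleC_left mult_scaleC_right scaleC_scaleC mult.commute)

lemma bounded_linear_scaleC: "bounded_linear (scaleC a :: 'a::cstar_algebra \<Rightarrow> 'a)"
  by (rule bounded_linear_intro[where K = "cmod a"])
     (simp_all add: scaleC_add_right scaleR_scaleC scaleC_scaleC norm_scaleC mult.commute)

lemma adj_one [simp]: "adj (1::'a::cstar_algebra) = 1"
  by (metis adj_adj adj_mult mult_1)

lemma norm_adj [simp]: "norm (adj x) = norm (x::'a::cstar_algebra)"
proof -
  have le: "norm y \<le> norm (adj y)" for y :: 'a
  proof (cases "y = 0")
    case False
    have "norm y * norm y \<le> norm (adj y) * norm y"
      using norm_mult_ineq[of "adj y" y] by (simp add: cstar_identity power2_eq_square)
    then show ?thesis using False by simp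
  qed simp
  show ?thesis
    using le[of x] le[of "adj x"] by (simp add: adj_adj)
qed

lemma bounded_linear_adj: "bounded_linear (adj :: 'a::cstar_algebra \<Rightarrow> 'a)"
  by (rule bounded_linear_intro[where K = 1])
     (simp_all add: adj_add scaleR_scaleC adj_scaleC)

lemma adj_power: "adj (x ^ n) = adj (x::'a::cstar_algebra) ^ n"
  by (induction n) (simp_all add: adj_mult power_commutes)

lemma norm_unitary:
  assumes "unitary (u::'a::cstar_algebra)"
  shows "norm u = 1"
proof -
  have "(norm u)\<^sup>2 = 1"
    using cstar_identity[of u] assms by (simp add: unitary_def)
  then show ?thesis
    by (simp add: power2_eq_1_iff) (smt (verit) norm_ge_zero)
qed

text \<open>The binomial series of \<open>sqrt (1 + x)\<close> converges absolutely at \<open>h\<close>. Its Cauchy square has the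
coefficients \<open>1 gchoose n\<close> by Vandermonde's identity, so it breaks off after the linear term. This
replaces the continuous functional calculus.\<close>

lemma selfadjoint_square_root:
  assumes "norm (h::'a::cstar_algebra) < 1" "adj h = h"
  obtains y where "adj y = y" "y * y = 1 + h"
proof -
  define c where "c = (\<lambda>n. (1/2::real) gchoose n)"
  define y where "y = (\<Sum>n. c n *\<^sub>R h ^ n)"
  have norm_summable: "summable (\<lambda>n. norm (c n *\<^sub>R h ^ n))"
  proof -
    define r where "r = (norm h + 1) / 2"
    have r: "norm h < r" "\<bar>r\<bar> < 1"
      using assms(1) norm_ge_zero[of h] by (auto simp: r_def)
    have "summable (\<lambda>n. c n * r ^ n)"
      using gen_binomial_real[OF r(2), of "1/2"] by (auto simp: c_def sums_iff)
    then have "summable (\<lambda>n. norm (c n * norm h ^ n))"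
      by (rule powser_insidea) (use r in simp)
    then show ?thesis
    proof (rule summable_comparison_test'[where N = 0])
      fix n
      show "norm (norm (c n *\<^sub>R h ^ n)) \<le> norm (c n * norm h ^ n)"
        using norm_power_ineq[of h n] by (simp add: abs_mult mult_left_mono)
    qed
  qed
  then have sums: "(\<lambda>n. c n *\<^sub>R h ^ n) sums y"
    unfolding y_def by (rule summable_sums[OF summable_norm_cancel])
  have "(\<lambda>n. \<Sum>i\<le>n. (c i *\<^sub>R h ^ i) * (c (n - i) *\<^sub>R h ^ (n - i))) sums (y * y)"
    using Cauchy_product_sums[OF norm_summable norm_summable] by (simp add: y_def)
  moreover have "(\<Sum>i\<le>n. (c i *\<^sub>R h ^ i) * (c (n - i) *\<^sub>R h ^ (n - i)))
      = (1 gchoose n) *\<^sub>R h ^ n" for n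
  proof -
    have "(\<Sum>i\<le>n. (c i *\<^sub>R h ^ i) * (c (n - i) *\<^sub>R h ^ (n - i)))
        = (\<Sum>i\<le>n. c i * c (n - i)) *\<^sub>R h ^ n"
      unfolding scaleR_sum_left
    proof (rule sum.cong)
      fix i assume "i \<in> {..n}"
      then have "h ^ n = h ^ i * h ^ (n - i)"
        by (simp add: power_add[symmetric])
      then show "(c i *\<^sub>R h ^ i) * (c (n - i) *\<^sub>R h ^ (n - i)) = (c i * c (n - i)) *\<^sub>R h ^ n"
        by simp
    qed simp
    also have "(\<Sum>i\<le>n. c i * c (n - i)) = 1 gchoose n"
      unfolding c_def using gbinomial_Vandermonde[of "1/2::real" "1/2" n]
        by (simp add: atLeast0AtMost)
    finally show ?thesis .
  qed
  ultimately have "(\<lambda>n. (1 gchoose n :: real) *\<^sub>R h ^ n) sums (y * y)" by simp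
  moreover have "(\<lambda>n. (1 gchoose n :: real) *\<^sub>R h ^ n) sums (\<Sum>n\<in>{0,1}. (1 gchoose n :: real) *\<^sub>R h ^ n)"
  proof (rule sums_finite)
    fix n :: nat assume "n \<notin> {0, 1}"
    then have "(1::real) gchoose n = 0"
      using binomial_gbinomial[of 1 n, where ?'a = real, symmetric] by (simp add: binomial_eq_0)
    then show "((1::real) gchoose n) *\<^sub>R h ^ n = 0" by simp
  qed simp
  ultimately have "y * y = 1 + h"
    using sums_unique2 by fastforce
  moreover have "adj y = y"
  proof -
    have "(\<lambda>n. adj (c n *\<^sub>R h ^ n)) sums adj y"
      by (rule bounded_linear.sums[OF bounded_linear_adj sums])
    moreover have "adj (c n *\<^sub>R h ^ n) = c n *\<^sub>R h ^ n" for n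
      by (simp add: scaleR_scaleC adj_scaleC adj_power assms(2))
    ultimately show ?thesis
      using sums sums_unique2 by fastforce
  qed
  ultimately show thesis using that by blast
qed

locale cstar_trace =
  fixes \<tau> :: "'a::cstar_algebra \<Rightarrow> complex"
  assumes trace: "faithful_tracial_state \<tau>"
begin

lemma trace_add: "\<tau> (x + y) = \<tau> x + \<tau> y"
  and trace_scaleC: "\<tau> (scaleC a x) = a * \<tau> x"
  and trace_pos: "\<tau> (adj x * x) \<in> \<real>\<^sub>\<ge>\<^sub>0"
  and trace_one [simp]: "\<tau> 1 = 1"
  and trace_commute: "\<tau> (x * y) = \<tau> (y * x)"
proof -
  note * = trace[unfolded faithful_tracial_state_def]
  show "\<tau> (x + y) = \<tau> x + \<tau> y" using *[THEN conjunct1] by blast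
  show "\<tau> (scaleC a x) = a * \<tau> x" using *[THEN conjunct2, THEN conjunct1] by blast
  show "\<tau> (adj x * x) \<in> \<real>\<^sub>\<ge>\<^sub>0" using *[THEN conjunct2, THEN conjunct2, THEN conjunct1] by blast
  show "\<tau> 1 = 1" using * by blast
  show "\<tau> (x * y) = \<tau> (y * x)"
    using *[THEN conjunct2, THEN conjunct2, THEN conjunct2, THEN conjunct2, THEN conjunct1] by blast
qed

lemma trace_zero [simp]: "\<tau> 0 = 0"
  using trace_add[of 0 0] by simp

lemma trace_minus: "\<tau> (- x) = - \<tau> x"
  using trace_add[of x "- x"] by (simp add: eq_neg_iff_add_eq_0 add.commute)

lemma trace_diff: "\<tau> (x - y) = \<tau> x - \<tau> y"
  using trace_add[of x "- y"] by (simp add: trace_minus)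

lemma trace_scaleR: "\<tau> (r *\<^sub>R x) = r *\<^sub>R \<tau> x"
  by (simp add: scaleR_scaleC trace_scaleC scaleR_conv_of_real)

text \<open>Positivity of this expression is used twice: with \<open>c = 1\<close> and \<open>c = \<i>\<close> its being real determines
the trace of an adjoint, and with \<open>c\<close> the trace of \<open>x\<close> it is the Cauchy--Schwarz inequality.\<close>

lemma trace_shifted_square:
  "\<tau> (adj (x - scaleC c 1) * (x - scaleC c 1))
     = \<tau> (adj x * x) - c * \<tau> (adj x) - cnj c * \<tau> x + c * cnj c"
proof -
  have "adj (x - scaleC c 1) = adj x - scaleC (cnj c) 1"
    using linear_simps(2)[OF bounded_linear_adj, of x "scaleC c 1"]
    by (simp add: adj_scaleC)
  then show ?thesis
    by (simp only: left_diff_distrib right_diff_distrib mult_scaleC_left mult_scaleC_right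
        trace_diff trace_scaleC scaleC_scaleC mult_1_left mult_1_right trace_one)
       (simp add: algebra_simps)
qed

lemma trace_adj: "\<tau> (adj x) = cnj (\<tau> x)"
proof -
  have "\<tau> (adj x * x) \<in> \<real>\<^sub>\<ge>\<^sub>0" "\<tau> (adj (x - scaleC 1 1) * (x - scaleC 1 1)) \<in> \<real>\<^sub>\<ge>\<^sub>0"
    "\<tau> (adj (x - scaleC \<i> 1) * (x - scaleC \<i> 1)) \<in> \<real>\<^sub>\<ge>\<^sub>0"
    by (rule trace_pos)+
  then show ?thesis
    unfolding trace_shifted_square complex_nonneg_Reals_iff by (simp add: complex_eq_iff)
qed

text \<open>Positivity only speaks of squares. It reaches a selfadjoint strict contraction because the
  sum of the unit and such an element is the square of a selfadjoint element.\<close>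

lemma trace_selfadjoint_le:
  assumes "adj h = h"
  shows "Re (\<tau> h) \<le> norm h"
proof (rule field_le_epsilon)
  fix e :: real assume e: "e > 0"
  define k where "k = - (inverse (norm h + e)) *\<^sub>R h"
  have pos: "norm h + e > 0" using e norm_ge_zero[of h] by linarith
  have "norm k < 1"
    using e pos by (simp add: k_def divide_simps)
  moreover have "adj k = k"
    by (simp add: k_def assms linear_simps[OF bounded_linear_adj])
  ultimately obtain y where y: "adj y = y" "y * y = 1 + k"
    by (rule selfadjoint_square_root)
  have "\<tau> (1 + k) \<in> \<real>\<^sub>\<ge>\<^sub>0"
    using trace_pos[of y] y by simp
  then have "0 \<le> 1 - Re (\<tau> h) / (norm h + e)"
    by (simp add: k_def trace_add trace_minus trace_diff trace_scaleR complex_nonneg_Reals_iff field_simps)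
  then show "Re (\<tau> h) \<le> norm h + e"
    using pos by (simp add: field_simps)
qed

lemma norm_trace_le: "norm (\<tau> x) \<le> norm x"
proof -
  have "0 \<le> Re (\<tau> (adj (x - scaleC (\<tau> x) 1) * (x - scaleC (\<tau> x) 1)))"
    using trace_pos complex_nonneg_Reals_iff by blast
  then have "(norm (\<tau> x))\<^sup>2 \<le> Re (\<tau> (adj x * x))"
    unfolding trace_shifted_square trace_adj
    by (simp add: cmod_power2) (simp add: power2_eq_square)
  also have "\<dots> \<le> norm (adj x * x)"
    by (rule trace_selfadjoint_le) (simp add: adj_mult adj_adj)
  finally show ?thesis
    by (simp add: cstar_identity)
qed

lemma bounded_linear_trace: "bounded_linear \<tau>"
  by (rule bounded_linear_intro[where K = 1])
     (simp_all add: trace_add trace_scaleR norm_trace_le)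

end

section \<open>The moment generating function of a law on the circle\<close>

text \<open>The moment generating function has value \<open>1 + \<psi>\<close> for the usual \<open>\<psi>\<close>-transform, and \<open>1 - 1 / mgf\<close> is
the \<open>\<eta>\<close>-transform.\<close>

definition mgf :: "complex measure \<Rightarrow> complex \<Rightarrow> complex" where
  "mgf M z = (\<integral>t. 1 / (1 - t * z) \<partial>M)"

text \<open>Multiplied by \<open>1 - (norm z)\<^sup>2\<close> this is the Poisson integral of the law at \<open>cnj z\<close>.\<close>

definition energy :: "complex measure \<Rightarrow> complex \<Rightarrow> real" where
  "energy M z = (\<integral>t. 1 / (cmod (1 - t * z))\<^sup>2 \<partial>M)"

text \<open>The Cauchy--Schwarz quotient of the kernel \<open>1 / (1 - t * z)\<close>. Subordination bounds it by the sum of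
the corresponding quotients of the factors, less \<open>(norm z)\<^sup>2\<close>; near a singularity on the circle it
is controlled by the single atom located there.\<close>

definition concentration :: "complex measure \<Rightarrow> complex \<Rightarrow> real" where
  "concentration M z = (cmod (mgf M z))\<^sup>2 / energy M z"

locale circle_law = prob_space M for M :: "complex measure" +
  assumes sets_M: "sets M = sets circle_borel"
begin

lemma space_M: "space M = unit_circle"
  using sets_eq_imp_space_eq[OF sets_M] by simp

lemma circle_Borel_sets: "A \<in> sets borel \<Longrightarrow> A \<inter> unit_circle \<in> sets M"
  unfolding sets_M by (auto simp: sets_restrict_space)

lemma singleton_sets: "{a} \<in> sets M" if "a \<in> unit_circle"
  using circle_Borel_sets[of "{a}"] that by simp

lemma continuous_measurable:
  fixes f :: "complex \<Rightarrow> 'b::topological_space"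
  assumes "continuous_on unit_circle f"
  shows "f \<in> borel_measurable M"
  using borel_measurable_continuous_on_restrict[OF assms] measurable_cong_sets[OF sets_M refl]
  by blast

lemma continuous_integrable:
  fixes f :: "complex \<Rightarrow> 'b::{banach,second_countable_topology}"
  assumes "continuous_on unit_circle f"
  shows "integrable M f"
proof -
  have "bounded (f ` unit_circle)"
    by (intro compact_imp_bounded compact_continuous_image assms) simp
  then obtain B where "\<And>t. t \<in> unit_circle \<Longrightarrow> norm (f t) \<le> B"
    by (metis bounded_iff imageI)
  then show ?thesis
    by (intro integrable_const_bound[where B = B] continuous_measurable assms)
       (auto simp: space_M)
qed

lemma circle_denominator:
  assumes "t \<in> unit_circle" "norm z < 1"
  shows "1 - t * z \<noteq> 0" "1 - norm z \<le> norm (1 - t * z)"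
proof -
  show "1 - norm z \<le> norm (1 - t * z)"
    using assms norm_triangle_ineq2[of 1 "t * z"] by (simp add: norm_mult)
  then show "1 - t * z \<noteq> 0" using assms(2) by auto
qed

lemma continuous_kernels:
  assumes "norm z < 1"
  shows "continuous_on unit_circle (\<lambda>t. 1 / (1 - t * z))"
    and "continuous_on unit_circle (\<lambda>t. 1 / cmod (1 - t * z))"
    and "continuous_on unit_circle (\<lambda>t. 1 / (cmod (1 - t * z))\<^sup>2)"
  using circle_denominator(1)[OF _ assms] by (intro continuous_intros; auto)+

lemmas integrable_kernels = continuous_kernels[THEN continuous_integrable]

lemma mgf_zero [simp]: "mgf M 0 = 1"
  by (simp add: mgf_def prob_space)

lemma norm_mgf_le:
  assumes "norm z < 1"
  shows "norm (mgf M z) \<le> 1 / (1 - norm z)"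
proof -
  have "norm (mgf M z) \<le> (\<integral>t. 1 / (1 - norm z) \<partial>M)"
    unfolding mgf_def
  proof (rule Bochner_Integration.integral_norm_bound_integral[OF integrable_kernels(1)[OF assms]])
    fix t assume "t \<in> space M"
    then show "norm (1 / (1 - t * z)) \<le> 1 / (1 - norm z)"
      using circle_denominator[of t z] assms by (simp add: norm_divide space_M frac_le)
  qed simp
  then show ?thesis by (simp add: prob_space)
qed

text \<open>For \<open>norm x < 1\<close> the Poisson kernel is \<open>Re (2 / (1 - x) - 1)\<close>, and \<open>norm (t * z) = norm z\<close> on the circle.\<close>

lemma Re_mgf:
  assumes "norm z < 1"
  shows "2 * Re (mgf M z) - 1 = (1 - (norm z)\<^sup>2) * energy M z"
proof -
  have kernel: "2 * Re (1 / (1 - t * z)) - 1 = (1 - (norm z)\<^sup>2) * (1 / (cmod (1 - t * z))\<^sup>2)"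
    if "t \<in> unit_circle" for t
  proof -
    define x where "x = t * z"
    have x: "norm x = norm z" "1 - x \<noteq> 0"
      using that circle_denominator[OF that assms] by (auto simp: x_def norm_mult)
    have "2 * Re (1 / (1 - x)) - 1 = (2 * Re (1 - x) - (cmod (1 - x))\<^sup>2) / (cmod (1 - x))\<^sup>2"
    proof -
      have "Re (1 / (1 - x)) = Re (1 - x) / (cmod (1 - x))\<^sup>2"
        unfolding cmod_power2 by (simp add: Re_divide)
      then show ?thesis using x(2) by (simp add: diff_divide_distrib)
    qed
    also have "2 * Re (1 - x) - (cmod (1 - x))\<^sup>2 = 1 - (cmod x)\<^sup>2"
      by (simp only: cmod_power2) (simp add: power2_eq_square algebra_simps)
    finally show ?thesis unfolding x(1) by (simp add: x_def)
  qed
  have "2 * Re (mgf M z) - 1 = (\<integral>t. 2 * Re (1 / (1 - t * z)) - 1 \<partial>M)"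
    unfolding mgf_def using integrable_kernels(1)[OF assms]
    by (simp add: prob_space del: Re_divide_numeral)
  also have "\<dots> = (\<integral>t. (1 - (norm z)\<^sup>2) * (1 / (cmod (1 - t * z))\<^sup>2) \<partial>M)"
    by (rule Bochner_Integration.integral_cong) (auto simp: kernel space_M simp del: times_divide_eq_right)
  also have "\<dots> = (1 - (norm z)\<^sup>2) * energy M z"
    unfolding energy_def by (rule integral_mult_right_zero)
  finally show ?thesis .
qed

lemma energy_ge:
  assumes "norm z < 1"
  shows "1 / 4 \<le> energy M z"
proof -
  have "(\<integral>t. 1 / 4 \<partial>M) \<le> energy M z"
    unfolding energy_def
  proof (rule integral_mono[OF _ integrable_kernels(3)[OF assms]])
    fix t assume "t \<in> space M"
    then have "cmod (1 - t * z) \<le> 2"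
      using norm_triangle_ineq4[of 1 "t * z"] assms by (simp add: norm_mult space_M)
    then have "(cmod (1 - t * z))\<^sup>2 \<le> 2\<^sup>2"
      by (rule power_mono) simp
    then show "1 / 4 \<le> 1 / (cmod (1 - t * z))\<^sup>2"
      using circle_denominator(1)[of t z] assms \<open>t \<in> space M\<close>
      by (intro divide_left_mono) (auto simp: space_M)
  qed simp
  then show ?thesis by (simp add: prob_space)
qed

lemma energy_le:
  assumes "norm z < 1"
  shows "energy M z \<le> 1 / (1 - norm z)\<^sup>2"
proof -
  have "energy M z \<le> (\<integral>t. 1 / (1 - norm z)\<^sup>2 \<partial>M)"
    unfolding energy_def
  proof (rule integral_mono[OF integrable_kernels(3)[OF assms]])
    fix t assume "t \<in> space M"
    then have "(1 - norm z)\<^sup>2 \<le> (cmod (1 - t * z))\<^sup>2"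
      using circle_denominator[of t z] assms by (intro power_mono) (auto simp: space_M)
    then show "1 / (cmod (1 - t * z))\<^sup>2 \<le> 1 / (1 - norm z)\<^sup>2"
      using assms by (intro divide_left_mono) (auto intro!: mult_pos_pos simp: circle_denominator(1) \<open>t \<in> space M\<close>[unfolded space_M])
  qed simp
  then show ?thesis by (simp add: prob_space)
qed

lemma Re_mgf_gt: "1 / 2 < Re (mgf M z)" if "norm z < 1"
proof -
  have "0 < (1 - (norm z)\<^sup>2) * energy M z"
    using energy_ge[OF that] that by (intro mult_pos_pos) (auto simp: abs_square_less_1)
  then show ?thesis using Re_mgf[OF that] by simp
qed

lemma mgf_nonzero: "mgf M z \<noteq> 0" if "norm z < 1"
  using Re_mgf_gt[OF that] by auto

lemma concentration_pos: "0 < concentration M z" if "norm z < 1"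
  using mgf_nonzero[OF that] energy_ge[OF that] by (simp add: concentration_def)

text \<open>Only the measure of the set enters, which is what makes a small arc around a light point contribute
little. With \<open>f\<close> the kernel and \<open>J\<close> the integral to be bounded, the inequality expresses that the
square of \<open>p * f - J * indicator A\<close> has a nonnegative integral.\<close>

lemma restricted_Cauchy_Schwarz:
  assumes "norm z < 1" "A \<in> sets M" "measure M A \<le> p" "p > 0"
  shows "(\<integral>t. indicator A t * (1 / cmod (1 - t * z)) \<partial>M)\<^sup>2 \<le> p * energy M z"
proof -
  let ?f = "\<lambda>t. 1 / cmod (1 - t * z)"
  define J where "J = (\<integral>t. indicator A t * ?f t \<partial>M)"
  have int: "integrable M (\<lambda>t. indicator A t * ?f t)"
    using integrable_mult_indicator[OF assms(2) integrable_kernels(2)[OF assms(1)]] by simp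
  have sq: "(p * ?f t - J * indicator A t)\<^sup>2
      = p\<^sup>2 * (1 / (cmod (1 - t * z))\<^sup>2) - 2 * p * J * (indicator A t * ?f t) + J\<^sup>2 * indicator A t" for t
    by (simp add: power2_diff power_mult_distrib power_divide indicator_def)
  have "0 \<le> (\<integral>t. (p * ?f t - J * indicator A t)\<^sup>2 \<partial>M)" by simp
  also have "\<dots> = p\<^sup>2 * energy M z - 2 * p * J * J + J\<^sup>2 * measure M A"
  proof -
    have lin: "(\<integral>t. a * f t - b * g t + c * h t \<partial>M)
        = a * integral\<^sup>L M f - b * integral\<^sup>L M g + c * integral\<^sup>L M h"
      if "integrable M f" "integrable M g" "integrable M h" for a b c and f g h :: "complex \<Rightarrow> real"
      using that by simp
    have "integrable M (indicator A :: complex \<Rightarrow> real)"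
      using assms(2) by (rule integrable_real_indicator) (simp add: less_top[symmetric])
    from lin[OF integrable_kernels(3)[OF assms(1)] int this, of "p\<^sup>2" "2 * p * J" "J\<^sup>2"]
    moreover have "(\<integral>t. indicator A t \<partial>M) = measure M A"
      using sets.sets_into_space[OF assms(2)] by (simp add: Int_absorb2)
    ultimately show ?thesis
      unfolding sq energy_def J_def[symmetric] by simp
  qed
  also have "J\<^sup>2 * measure M A \<le> J\<^sup>2 * p"
    using assms(3) by (intro mult_left_mono) auto
  finally have "0 \<le> p * (p * energy M z - J\<^sup>2)"
    by (simp add: power2_eq_square algebra_simps)
  then show ?thesis
    using assms(4) by (simp add: zero_le_mult_iff J_def)
qed

lemma norm_mgf_le_local:
  assumes "norm z < 1" "A \<in> sets M" "c \<ge> 0"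
    and away: "\<And>t. t \<in> unit_circle - A \<Longrightarrow> 1 / cmod (1 - t * z) \<le> c"
  shows "norm (mgf M z) \<le> c + (\<integral>t. indicator A t * (1 / cmod (1 - t * z)) \<partial>M)"
proof -
  have int: "integrable M (\<lambda>t. indicator A t * (1 / cmod (1 - t * z)))"
    using integrable_mult_indicator[OF assms(2) integrable_kernels(2)[OF assms(1)]] by simp
  have "norm (mgf M z) \<le> (\<integral>t. c + indicator A t * (1 / cmod (1 - t * z)) \<partial>M)"
    unfolding mgf_def
  proof (rule Bochner_Integration.integral_norm_bound_integral[OF integrable_kernels(1)[OF assms(1)]])
    show "integrable M (\<lambda>t. c + indicator A t * (1 / cmod (1 - t * z)))"
      using int by simp
    fix t assume "t \<in> space M"
    then show "norm (1 / (1 - t * z)) \<le> c + indicator A t * (1 / cmod (1 - t * z))"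
      using away[of t] assms(3) by (cases "t \<in> A") (auto simp: space_M norm_divide)
  qed
  also have "\<dots> = c + (\<integral>t. indicator A t * (1 / cmod (1 - t * z)) \<partial>M)"
    using int by (simp add: prob_space del: times_divide_eq_right mult_1_right)
  finally show ?thesis .
qed

lemma small_arc_measure:
  assumes "a \<in> unit_circle" "e > 0"
  obtains d where "d > 0" "measure M (ball a d \<inter> unit_circle) < measure M {a} + e"
proof -
  let ?A = "\<lambda>n. ball a (1 / Suc n) \<inter> unit_circle"
  have "(\<lambda>n. measure M (?A n)) \<longlonglongrightarrow> measure M (\<Inter>n. ?A n)"
  proof (rule finite_Lim_measure_decseq)
    show "range ?A \<subseteq> sets M" using circle_Borel_sets by auto
    show "decseq ?A"
      by (intro decseq_SucI Int_mono subset_ball) (auto simp: field_simps)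
  qed
  moreover have "(\<Inter>n. ?A n) = {a}"
  proof -
    have "x = a" if "\<And>n. dist a x < 1 / Suc n" for x
    proof (rule ccontr)
      assume "x \<noteq> a"
      then obtain n where "inverse (real (Suc n)) < dist a x"
        using reals_Archimedean[of "dist a x"] by auto
      then show False using that[of n] by (simp add: field_simps)
    qed
    then show ?thesis using assms(1) by auto
  qed
  ultimately have "(\<lambda>n. measure M (?A n)) \<longlonglongrightarrow> measure M {a}" by simp
  then have "\<forall>\<^sub>F n in sequentially. measure M (?A n) < measure M {a} + e"
    using assms(2) by (intro order_tendstoD(2)) auto
  then obtain n where "measure M (?A n) < measure M {a} + e"
    by (auto simp: eventually_sequentially)
  then show thesis using that[of "1 / Suc n"] by simp
qed

text \<open>Away from an arc around \<open>cnj \<xi>\<close> the kernel stays bounded as \<open>w n\<close> approaches \<open>\<xi>\<close>, so the blow-up of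
the transform comes from the arc alone. There Cauchy--Schwarz costs the measure of the arc, and the
arc can be chosen with measure close to that of its centre. The bounded contribution is absorbed by
the factor \<open>k > 1\<close> once the transform is large.\<close>

lemma concentration_at_singularity:
  assumes w: "\<And>n. norm (w n) < 1" "w \<longlonglongrightarrow> \<xi>" "norm \<xi> = 1"
    and inf: "filterlim (\<lambda>n. norm (mgf M (w n))) at_top sequentially" and "e > 0"
  shows "\<forall>\<^sub>F n in sequentially. concentration M (w n) < measure M {cnj \<xi>} + e"
proof -
  define m where "m = measure M {cnj \<xi>}"
  define p where "p = m + e / 2"
  define k where "k = sqrt ((m + e) / p)"
  have p: "p > 0" using \<open>e > 0\<close> by (simp add: p_def m_def add_nonneg_pos)
  then have k: "k > 1" using \<open>e > 0\<close> by (simp add: k_def p_def)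
  obtain d where d: "d > 0" "measure M (ball (cnj \<xi>) d \<inter> unit_circle) < p"
    using small_arc_measure[of "cnj \<xi>" "e / 2"] w(3) \<open>e > 0\<close> by (auto simp: p_def m_def)
  define A where "A = ball (cnj \<xi>) d \<inter> unit_circle"
  define c where "c = 2 / d"
  have A: "A \<in> sets M" using circle_Borel_sets by (simp add: A_def)
  have "\<forall>\<^sub>F n in sequentially. dist (w n) \<xi> < d / 2"
    using w(2) d(1) by (intro tendstoD) auto
  moreover have "\<forall>\<^sub>F n in sequentially. norm (mgf M (w n)) > max c (k * c / (k - 1))"
    using inf unfolding filterlim_at_top_dense by blast
  ultimately show ?thesis
  proof eventually_elim
    case (elim n)
    let ?g = "norm (mgf M (w n))"
    define J where "J = (\<integral>t. indicator A t * (1 / cmod (1 - t * w n)) \<partial>M)"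
    have I: "energy M (w n) > 0" using energy_ge[OF w(1)[of n]] by simp
    have "?g \<le> c + J"
      unfolding J_def
    proof (rule norm_mgf_le_local[OF w(1) A])
      show "c \<ge> 0" using d(1) by (simp add: c_def)
      fix t assume t: "t \<in> unit_circle - A"
      then have "t * cnj t = 1" by (simp add: complex_norm_square[symmetric])
      then have "1 - t * w n = t * (cnj t - w n)" by (simp add: right_diff_distrib)
      then have "cmod (1 - t * w n) = cmod (cnj t - w n)"
        using t by (simp add: norm_mult)
      moreover have "d \<le> dist (cnj \<xi>) t" using t by (auto simp: A_def)
      then have "d \<le> cmod (cnj t - \<xi>)"
        by (metis complex_cnj_cnj complex_cnj_diff complex_mod_cnj dist_commute dist_norm)
      moreover have "cmod (cnj t - \<xi>) \<le> cmod (cnj t - w n) + cmod (w n - \<xi>)"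
        using norm_triangle_ineq[of "cnj t - w n" "w n - \<xi>"] by simp
      ultimately have "d / 2 \<le> cmod (1 - t * w n)"
        using elim(1) by (simp add: dist_norm)
      then show "1 / cmod (1 - t * w n) \<le> c"
        using d(1) frac_le[of 1 1 "d / 2" "cmod (1 - t * w n)"] by (simp add: c_def)
    qed
    then have "(?g - c)\<^sup>2 \<le> J\<^sup>2"
      using elim(2) by (intro power_mono) auto
    also have "J\<^sup>2 \<le> p * energy M (w n)"
      unfolding J_def using d(2) p by (intro restricted_Cauchy_Schwarz[OF w(1) A]) (auto simp: A_def)
    finally have le: "(?g - c)\<^sup>2 \<le> p * energy M (w n)" .
    have "?g < k * (?g - c)"
      using elim(2) k by (simp add: field_simps)
    then have "?g\<^sup>2 < (k * (?g - c))\<^sup>2"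
      by (intro power_strict_mono) auto
    also have "\<dots> = (m + e) / p * (?g - c)\<^sup>2"
      using p \<open>e > 0\<close> by (simp add: power_mult_distrib k_def m_def)
    also have "\<dots> \<le> (m + e) / p * (p * energy M (w n))"
      using le p \<open>e > 0\<close> by (intro mult_left_mono) (auto simp: m_def)
    finally show ?case
      using p I by (simp add: concentration_def m_def[symmetric] pos_divide_less_eq)
  qed
qed

lemma circle_transform_sums:
  fixes g :: "complex \<Rightarrow> complex"
  assumes z: "norm z < 1" and g: "continuous_on unit_circle g"
  shows "(\<lambda>n. (\<integral>t. g t * t ^ n \<partial>M) * z ^ n) sums (\<integral>t. g t / (1 - t * z) \<partial>M)"
proof -
  have cont: "continuous_on unit_circle (\<lambda>t. g t * (t * z) ^ n)" for n
    by (intro continuous_intros g)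
  have norm: "norm (g t * (t * z) ^ n) = norm (g t) * norm z ^ n" if "t \<in> unit_circle" for t n
    using that by (simp add: norm_power norm_mult)
  have geo: "summable (\<lambda>n. norm z ^ n)"
    using z by (intro summable_geometric) simp
  have "(\<lambda>n. \<integral>t. g t * (t * z) ^ n \<partial>M) sums (\<integral>t. (\<Sum>n. g t * (t * z) ^ n) \<partial>M)"
  proof (rule sums_integral)
    show "integrable M (\<lambda>t. g t * (t * z) ^ n)" for n
      by (rule continuous_integrable[OF cont])
    show "AE t in M. summable (\<lambda>n. norm (g t * (t * z) ^ n))"
    proof (rule AE_I2)
      fix t assume "t \<in> space M"
      then show "summable (\<lambda>n. norm (g t * (t * z) ^ n))"
        using summable_mult[OF geo, of "norm (g t)"] by (simp only: norm space_M)
    qed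
    have "(\<integral>t. norm (g t * (t * z) ^ n) \<partial>M) = (\<integral>t. norm (g t) * norm z ^ n \<partial>M)" for n
      by (rule Bochner_Integration.integral_cong) (simp_all add: norm space_M)
    also have "(\<integral>t. norm (g t) * norm z ^ n \<partial>M) = (\<integral>t. norm (g t) \<partial>M) * norm z ^ n" for n
      by (rule Bochner_Integration.integral_mult_left_zero)
    finally show "summable (\<lambda>n. \<integral>t. norm (g t * (t * z) ^ n) \<partial>M)"
      using summable_mult[OF geo] by simp
  qed
  also have "(\<integral>t. (\<Sum>n. g t * (t * z) ^ n) \<partial>M) = (\<integral>t. g t / (1 - t * z) \<partial>M)"
  proof (rule Bochner_Integration.integral_cong)
    fix t assume "t \<in> space M"
    then have "norm (t * z) < 1" using z by (simp add: space_M norm_mult)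
    from suminf_mult[OF summable_geometric[OF this], of "g t"] suminf_geometric[OF this]
    show "(\<Sum>n. g t * (t * z) ^ n) = g t / (1 - t * z)" by simp
  qed simp
  also have "(\<lambda>n. \<integral>t. g t * (t * z) ^ n \<partial>M) = (\<lambda>n. (\<integral>t. g t * t ^ n \<partial>M) * z ^ n)"
    by (simp only: power_mult_distrib mult.assoc[symmetric] Bochner_Integration.integral_mult_left_zero)
  finally show ?thesis .
qed

lemma circle_transform_holomorphic:
  fixes g :: "complex \<Rightarrow> complex"
  assumes "continuous_on unit_circle g"
  shows "(\<lambda>z. \<integral>t. g t / (1 - t * z) \<partial>M) holomorphic_on ball 0 1"
proof (rule power_series_holomorphic)
  fix z :: complex assume "z \<in> ball 0 1"
  then show "(\<lambda>n. (\<integral>t. g t * t ^ n \<partial>M) * (z - 0) ^ n) sums (\<integral>t. g t / (1 - t * z) \<partial>M)"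
    using circle_transform_sums[OF _ assms, of z] by simp
qed

lemma mgf_holomorphic: "mgf M holomorphic_on ball 0 1"
  using circle_transform_holomorphic[of "\<lambda>_. 1"] by (simp add: mgf_def[abs_def])

text \<open>The functions \<open>(1 - r) / (1 - t * r * \<zeta>)\<close> are bounded by 1 and converge to the indicator of \<open>cnj \<zeta>\<close>.\<close>

lemma mgf_at_atom:
  assumes r: "\<And>n. 0 \<le> r n" "\<And>n. r n < 1" "r \<longlonglongrightarrow> 1" and \<zeta>: "norm \<zeta> = 1"
  shows "(\<lambda>n. (1 - r n) *\<^sub>R mgf M (r n *\<^sub>R \<zeta>)) \<longlonglongrightarrow> of_real (measure M {cnj \<zeta>})"
proof -
  have norm: "norm (r n *\<^sub>R \<zeta>) < 1" for n using r(1,2)[of n] \<zeta> by simp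
  have "(\<lambda>n. \<integral>t. (1 - r n) *\<^sub>R (1 / (1 - t * (r n *\<^sub>R \<zeta>))) \<partial>M)
      \<longlonglongrightarrow> (\<integral>t. indicator {cnj \<zeta>} t *\<^sub>R (1::complex) \<partial>M)"
  proof (rule integral_dominated_convergence[where w = "\<lambda>_. 1"])
    show "(\<lambda>t. indicator {cnj \<zeta>} t *\<^sub>R (1::complex)) \<in> borel_measurable M"
      using singleton_sets[of "cnj \<zeta>"] \<zeta> by (intro borel_measurable_scaleR borel_measurable_indicator) auto
    show "(\<lambda>t. (1 - r n) *\<^sub>R (1 / (1 - t * (r n *\<^sub>R \<zeta>)))) \<in> borel_measurable M" for n
      using continuous_measurable[OF continuous_kernels(1)[OF norm]] by (intro borel_measurable_scaleR) auto
    show "AE t in M. norm ((1 - r n) *\<^sub>R (1 / (1 - t * (r n *\<^sub>R \<zeta>)))) \<le> 1" for n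
    proof (rule AE_I2)
      fix t assume "t \<in> space M"
      then have t: "t \<in> unit_circle" by (simp add: space_M)
      show "norm ((1 - r n) *\<^sub>R (1 / (1 - t * (r n *\<^sub>R \<zeta>)))) \<le> 1"
      proof -
        define D where "D = 1 - t * (r n *\<^sub>R \<zeta>)"
        have "D \<noteq> 0" "1 - r n \<le> norm D"
          using circle_denominator[OF t norm[of n]] \<zeta> r(1,2)[of n] by (auto simp: D_def)
        then show ?thesis
          unfolding D_def[symmetric] using r(2)[of n] by (simp add: norm_divide)
      qed
    qed
    show "AE t in M. (\<lambda>n. (1 - r n) *\<^sub>R (1 / (1 - t * (r n *\<^sub>R \<zeta>)))) \<longlonglongrightarrow> indicator {cnj \<zeta>} t *\<^sub>R (1::complex)"
    proof (rule AE_I2)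
      fix t assume "t \<in> space M"
      then have t: "norm t = 1" by (simp add: space_M)
      show "(\<lambda>n. (1 - r n) *\<^sub>R (1 / (1 - t * (r n *\<^sub>R \<zeta>)))) \<longlonglongrightarrow> indicator {cnj \<zeta>} t *\<^sub>R (1::complex)"
      proof (cases "t = cnj \<zeta>")
        case True
        have "cnj \<zeta> * \<zeta> = 1" using \<zeta> by (simp add: complex_norm_square[symmetric] mult.commute)
        then have D: "1 - t * (r n *\<^sub>R \<zeta>) = of_real (1 - r n)" for n
          by (simp add: True scaleR_conv_of_real)
        then have "(1 - r n) *\<^sub>R (1 / (1 - t * (r n *\<^sub>R \<zeta>))) = 1" for n
          unfolding D using r(2)[of n] by (simp add: scaleR_conv_of_real del: of_real_diff)
        then show ?thesis by (simp add: True)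
      next
        case False
        have "1 - t * \<zeta> \<noteq> 0"
        proof
          assume "1 - t * \<zeta> = 0"
          then have "cnj \<zeta> = t * (\<zeta> * cnj \<zeta>)" by (simp add: mult.assoc[symmetric])
          then show False using False \<zeta> by (simp add: complex_norm_square[symmetric])
        qed
        then have "(\<lambda>n. (1 - r n) *\<^sub>R (1 / (1 - t * (r n *\<^sub>R \<zeta>)))) \<longlonglongrightarrow> (1 - 1) *\<^sub>R (1 / (1 - t * (1 *\<^sub>R \<zeta>)))"
          using r(3) by (intro tendsto_intros) auto
        then show ?thesis using False by simp
      qed
    qed
  qed simp
  moreover have "(\<integral>t. (1 - r n) *\<^sub>R (1 / (1 - t * (r n *\<^sub>R \<zeta>))) \<partial>M) = (1 - r n) *\<^sub>R mgf M (r n *\<^sub>R \<zeta>)" for n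
    unfolding mgf_def by (rule Bochner_Integration.integral_scaleR_right)
  moreover have "(\<integral>t. indicator {cnj \<zeta>} t *\<^sub>R (1::complex) \<partial>M) = of_real (measure M {cnj \<zeta>})"
    using singleton_sets[of "cnj \<zeta>"] \<zeta>
    by (simp add: Int_absorb2 sets.sets_into_space scaleR_conv_of_real)
  ultimately show ?thesis by (simp only:)
qed

text \<open>At the point of modulus \<open>1 - d\<close> on the radius to \<open>cnj t\<close> the Poisson kernel is at least of order \<open>1 / d\<close> on the
ball of radius \<open>d\<close> around \<open>t\<close>.\<close>

lemma measure_cball_le_mgf:
  assumes "t \<in> unit_circle" "0 < d" "d < 1"
  shows "measure M (cball t d \<inter> unit_circle) \<le> 8 * norm (mgf M ((1 - d) *\<^sub>R cnj t)) * d"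
proof -
  let ?z = "(1 - d) *\<^sub>R cnj t" and ?A = "cball t d \<inter> unit_circle"
  have z: "norm ?z = 1 - d" "norm ?z < 1" using assms by auto
  have A: "?A \<in> sets M" using circle_Borel_sets by simp
  have "measure M ?A / (4 * d\<^sup>2) = (\<integral>s. indicator ?A s * (1 / (4 * d\<^sup>2)) \<partial>M)"
    using A by (simp add: Int_absorb2 sets.sets_into_space)
  also have "\<dots> \<le> energy M ?z"
    unfolding energy_def
  proof (rule integral_mono[OF _ integrable_kernels(3)[OF z(2)]])
    show "integrable M (\<lambda>s. indicator ?A s * (1 / (4 * d\<^sup>2)))"
      using integrable_mult_indicator[OF A, of "\<lambda>_. 1 / (4 * d\<^sup>2)"] by simp
    fix s assume "s \<in> space M"
    then have s: "s \<in> unit_circle" by (simp add: space_M)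
    show "indicator ?A s * (1 / (4 * d\<^sup>2)) \<le> 1 / (cmod (1 - s * ?z))\<^sup>2"
    proof (cases "s \<in> ?A")
      case True
      have "t * cnj t = 1" using assms(1) by (simp add: complex_norm_square[symmetric])
      then have "1 - s * ?z = of_real d + of_real (1 - d) * (t - s) * cnj t"
        by (simp add: scaleR_conv_of_real algebra_simps)
      also have "norm \<dots> \<le> d + (1 - d) * norm (t - s)"
        using norm_triangle_ineq[of "of_real d" "of_real (1 - d) * (t - s) * cnj t"] assms
        by (simp add: norm_mult del: of_real_diff)
      also have "\<dots> \<le> d + 1 * d"
        using True assms by (intro add_left_mono mult_mono) (auto simp: dist_norm)
      finally have "(cmod (1 - s * ?z))\<^sup>2 \<le> (2 * d)\<^sup>2"
        by (intro power_mono) auto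
      then show ?thesis
        using True circle_denominator(1)[OF s z(2)] assms(2)
        by (auto simp: power_mult_distrib intro!: divide_left_mono)
    qed simp
  qed
  finally have "measure M ?A \<le> 4 * d\<^sup>2 * energy M ?z"
    using assms(2) by (simp add: field_simps)
  moreover have "d * energy M ?z \<le> 2 * norm (mgf M ?z)"
  proof -
    have "1 - (norm ?z)\<^sup>2 = d * (2 - d)" unfolding z(1) by (simp add: power2_eq_square algebra_simps)
    then have "d * (2 - d) * energy M ?z = 2 * Re (mgf M ?z) - 1"
      using Re_mgf[OF z(2)] by simp
    moreover have "d * 1 * energy M ?z \<le> d * (2 - d) * energy M ?z"
      using assms energy_ge[OF z(2)] by (intro mult_right_mono mult_left_mono) auto
    ultimately show ?thesis using complex_Re_le_cmod[of "mgf M ?z"] by simp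
  qed
  then have "4 * d * (d * energy M ?z) \<le> 4 * d * (2 * norm (mgf M ?z))"
    using assms(2) by (intro mult_left_mono) auto
  ultimately show ?thesis by (simp add: power2_eq_square algebra_simps)
qed

lemma finite_heavy_atoms:
  assumes "e > 0"
  shows "finite {a \<in> unit_circle. e \<le> measure M {a}}"
proof (rule ccontr)
  let ?S = "{a \<in> unit_circle. e \<le> measure M {a}}"
  assume "infinite ?S"
  obtain n :: nat where n: "1 / e < n" using reals_Archimedean2 by blast
  obtain F where F: "F \<subseteq> ?S" "finite F" "card F = n"
    using infinite_arbitrarily_large[OF \<open>infinite ?S\<close>] by metis
  have "real n * e \<le> (\<Sum>a\<in>F. measure M {a})"
    using sum_mono[of F "\<lambda>_. e" "\<lambda>a. measure M {a}"] F by auto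
  also have "\<dots> = measure M F"
    using F singleton_sets by (intro finite_measure_eq_sum_singleton[symmetric]) auto
  also have "\<dots> \<le> 1" by simp
  finally show False using n assms by (simp add: field_simps)
qed

lemma maximal_atom:
  obtains a where "a \<in> unit_circle" "\<And>b. b \<in> unit_circle \<Longrightarrow> measure M {b} \<le> measure M {a}"
proof (cases "\<exists>b\<in>unit_circle. measure M {b} > 0")
  case True
  then obtain b where b: "b \<in> unit_circle" "measure M {b} > 0" by blast
  define S where "S = {a \<in> unit_circle. measure M {b} \<le> measure M {a}}"
  have S: "finite S" "S \<noteq> {}"
    using finite_heavy_atoms[OF b(2)] b by (auto simp: S_def)
  then have "Max ((\<lambda>c. measure M {c}) ` S) \<in> (\<lambda>c. measure M {c}) ` S"
    by (intro Max_in) auto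
  then obtain a where "a \<in> S" "Max ((\<lambda>c. measure M {c}) ` S) = measure M {a}" by auto
  then have a: "a \<in> S" "\<And>c. c \<in> S \<Longrightarrow> measure M {c} \<le> measure M {a}"
    using Max_ge[of "(\<lambda>c. measure M {c}) ` S"] S(1) by auto
  show thesis
  proof (rule that)
    show "a \<in> unit_circle" using a(1) by (simp add: S_def)
    fix c assume "c \<in> unit_circle"
    show "measure M {c} \<le> measure M {a}"
    proof (cases "c \<in> S")
      case False
      then show ?thesis using \<open>c \<in> unit_circle\<close> a(2)[of b] b(1) by (simp add: S_def)
    qed (rule a(2))
  qed
next
  case False
  then have "measure M {b} \<le> measure M {1}" if "b \<in> unit_circle" for b
  proof -
    have "measure M {b} \<le> 0" using that False by (simp add: not_less)
    then show ?thesis using measure_nonneg[of M "{1}"] by linarith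
  qed
  then show thesis
    using that[of 1] by simp
qed

lemma atom_less_1:
  assumes "\<not> point_mass M" "a \<in> unit_circle"
  shows "measure M {a} < 1"
proof (rule ccontr)
  assume "\<not> measure M {a} < 1"
  then have one: "measure M {a} = 1" using prob_le_1[of "{a}"] by linarith
  have "M = return circle_borel a"
  proof (rule measure_eqI)
    show "sets M = sets (return circle_borel a)" by (simp add: sets_M)
    fix A assume A: "A \<in> sets M"
    have "AE x in M. x \<in> {a}"
      using one singleton_sets[OF assms(2)] by (simp add: prob_eq_1)
    then have "AE x in M. (x \<in> A) = (a \<in> A)" by auto
    then have "emeasure M A = emeasure M {x \<in> space M. a \<in> A}"
      using A sets.sets_into_space[OF A]
      by (intro emeasure_eq_AE) auto
    also have "\<dots> = indicator A a" by (cases "a \<in> A") (auto simp: emeasure_space_1)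
    finally show "emeasure M A = emeasure (return circle_borel a) A"
      using A sets_M by simp
  qed
  then show False using assms by (auto simp: point_mass_def)
qed

end

lemma circle_law_iff: "circle_prob M \<longleftrightarrow> circle_law M"
  by (auto simp: circle_prob_def circle_law_def circle_law_axioms_def)

text \<open>Generating function of the moments from the first one on; it makes the quotient of the
\<open>\<eta>\<close>-transform by \<open>z\<close> meaningful at the origin.\<close>

definition shifted_mgf :: "complex measure \<Rightarrow> complex \<Rightarrow> complex" where
  "shifted_mgf M z = (\<integral>t. t / (1 - t * z) \<partial>M)"

definition eta_quotient :: "complex measure \<Rightarrow> complex \<Rightarrow> complex" where
  "eta_quotient M z = shifted_mgf M z / mgf M z"

context circle_law
begin

lemma mgf_eq_shifted:
  assumes "norm z < 1"
  shows "mgf M z = 1 + z * shifted_mgf M z"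
proof -
  have "integrable M (\<lambda>t. t / (1 - t * z))"
    using circle_denominator(1)[OF _ assms]
    by (intro continuous_integrable continuous_intros) auto
  then have "1 + z * shifted_mgf M z = (\<integral>t. 1 + z * (t / (1 - t * z)) \<partial>M)"
    by (simp add: shifted_mgf_def prob_space del: times_divide_eq_right)
  also have "\<dots> = mgf M z"
    unfolding mgf_def
    by (rule Bochner_Integration.integral_cong)
       (use circle_denominator(1)[OF _ assms] in \<open>auto simp: space_M field_simps\<close>)
  finally show ?thesis ..
qed

lemma eta_eq:
  assumes "norm z < 1"
  shows "z * eta_quotient M z = 1 - 1 / mgf M z"
  using mgf_eq_shifted[OF assms] mgf_nonzero[OF assms]
  by (simp add: eta_quotient_def field_simps)

lemma eta_quotient_holomorphic: "eta_quotient M holomorphic_on ball 0 1"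
proof -
  have "shifted_mgf M holomorphic_on ball 0 1"
    using circle_transform_holomorphic[of "\<lambda>t. t"] by (simp add: shifted_mgf_def[abs_def])
  then show ?thesis
    unfolding eta_quotient_def[abs_def]
    by (intro holomorphic_intros mgf_holomorphic) (auto simp: mgf_nonzero)
qed

lemma norm_eta_less_1:
  assumes "norm z < 1"
  shows "norm (1 - 1 / mgf M z) < 1"
proof -
  have "(norm (mgf M z - 1))\<^sup>2 < (norm (mgf M z))\<^sup>2"
    using Re_mgf_gt[OF assms] unfolding cmod_power2 by (simp add: power2_eq_square algebra_simps)
  then have "norm (mgf M z - 1) < norm (mgf M z)"
    by (rule power2_less_imp_less) simp
  moreover have "1 - 1 / mgf M z = (mgf M z - 1) / mgf M z"
    using mgf_nonzero[OF assms] by (simp add: diff_divide_distrib)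
  ultimately show ?thesis
    using mgf_nonzero[OF assms] by (simp only: norm_divide) simp
qed

text \<open>The \<open>\<eta>\<close>-transform is a self-map of the disc fixing the origin, so the Schwarz lemma applies. At
the origin itself the quotient is the first moment.\<close>

lemma norm_eta_quotient_le:
  assumes "norm z < 1"
  shows "norm (eta_quotient M z) \<le> 1"
proof (cases "z = 0")
  case True
  have "norm (shifted_mgf M 0) \<le> (\<integral>t. 1 \<partial>M)"
    unfolding shifted_mgf_def
    by (rule Bochner_Integration.integral_norm_bound_integral[OF continuous_integrable])
       (auto intro!: continuous_intros simp: space_M)
  then show ?thesis by (simp add: True eta_quotient_def prob_space)
next
  case False
  have "norm (z * eta_quotient M z) \<le> norm z"
  proof (rule Schwarz_Lemma(1)[of "\<lambda>z. z * eta_quotient M z"])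
    show "(\<lambda>z. z * eta_quotient M z) holomorphic_on ball 0 1"
      by (intro holomorphic_intros eta_quotient_holomorphic)
    show "norm (z * eta_quotient M z) < 1" if "norm z < 1" for z
      using norm_eta_less_1[OF that] by (simp only: eta_eq[OF that])
  qed (use assms in auto)
  then show ?thesis using False by (simp add: norm_mult)
qed

end

section \<open>Fixed points of holomorphic self-maps of the disc\<close>

lemma holomorphic_lipschitz_half_disc:
  assumes "h holomorphic_on ball 0 1"
  obtains L where "L > 0"
    "\<And>x y. norm x \<le> 1/2 \<Longrightarrow> norm y \<le> 1/2 \<Longrightarrow> norm (h x - h y) \<le> L * norm (x - y)"
proof -
  have sub: "cball 0 (1/2) \<subseteq> ball (0::complex) 1" by auto
  have "continuous_on (cball 0 (1/2)) (deriv h)"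
    using holomorphic_on_imp_continuous_on[OF holomorphic_deriv[OF assms open_ball]] sub
    by (rule continuous_on_subset)
  then have "bounded (deriv h ` cball 0 (1/2))"
    by (intro compact_imp_bounded compact_continuous_image) auto
  then obtain B where B: "B > 0" "\<forall>x\<in>deriv h ` cball 0 (1/2). norm x \<le> B"
    by (auto simp: bounded_pos)
  show thesis
  proof (rule that[OF B(1)])
    fix x y :: complex assume xy: "norm x \<le> 1/2" "norm y \<le> 1/2"
    show "norm (h x - h y) \<le> B * norm (x - y)"
    proof (rule field_differentiable_bound[where S = "cball 0 (1/2)" and f' = "deriv h"])
      fix z :: complex assume z: "z \<in> cball 0 (1/2)"
      show "(h has_field_derivative deriv h z) (at z within cball 0 (1/2))"
        using holomorphic_derivI[OF assms open_ball] z sub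
        by (meson has_field_derivative_at_within subsetD)
      show "norm (deriv h z) \<le> B" using B z by auto
    qed (use xy in auto)
  qed
qed

text \<open>For each \<open>z\<close> the map \<open>w \<mapsto> z * h2 (z * h1 w)\<close> sends the disc into the closed disc of radius \<open>norm z\<close>. The
iterates started at 0 are holomorphic in \<open>z\<close> and uniformly bounded, so by Montel's theorem a
subsequence converges on the whole disc. Its limit solves the equation near the origin, where the
map is a contraction, and then everywhere by the identity theorem.\<close>

lemma holomorphic_fixed_point:
  fixes h1 h2 :: "complex \<Rightarrow> complex"
  assumes hol: "h1 holomorphic_on ball 0 1" "h2 holomorphic_on ball 0 1"
    and le: "\<And>w. norm w < 1 \<Longrightarrow> norm (h1 w) \<le> 1" "\<And>w. norm w < 1 \<Longrightarrow> norm (h2 w) \<le> 1"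
  obtains \<omega> where "\<omega> holomorphic_on ball 0 1" "\<And>z. norm z < 1 \<Longrightarrow> norm (\<omega> z) \<le> norm z"
    "\<And>z. norm z < 1 \<Longrightarrow> \<omega> z = z * h2 (z * h1 (\<omega> z))"
proof -
  define \<Phi> where "\<Phi> = (\<lambda>z w. z * h2 (z * h1 w))"
  define f where "f = rec_nat (\<lambda>_. 0) (\<lambda>_ g z. \<Phi> z (g z))"
  have f: "f 0 = (\<lambda>_. 0)" "f (Suc n) = (\<lambda>z. \<Phi> z (f n z))" for n
    by (simp_all add: f_def)
  have h1z: "norm (z * h1 w) \<le> norm z" if "norm z < 1" "norm w < 1" for z w
    using mult_left_le[OF le(1)[OF that(2)], of "norm z"] by (simp add: norm_mult mult.commute)
  have \<Phi>_le: "norm (\<Phi> z w) \<le> norm z" if "norm z < 1" "norm w < 1" for z w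
    using mult_left_le[OF le(2), of "z * h1 w" "norm z"] h1z[OF that] that
    by (simp add: \<Phi>_def norm_mult mult.commute)
  have f_le: "norm (f n z) \<le> norm z" if "norm z < 1" for n z
  proof (induction n)
    case (Suc n)
    then show ?case using \<Phi>_le[of z "f n z"] that by (simp add: f)
  qed (simp add: f)
  have \<Phi>_hol: "(\<lambda>z. \<Phi> z (g z)) holomorphic_on ball 0 1"
    if g: "g holomorphic_on ball 0 1" "\<And>z. norm z < 1 \<Longrightarrow> norm (g z) \<le> norm z" for g
  proof -
    have 1: "(\<lambda>z. z * h1 (g z)) holomorphic_on ball 0 1"
      using holomorphic_on_compose_gen[OF g(1) hol(1)] g(2)
      by (intro holomorphic_intros) (force simp: o_def intro: le_less_trans)
    have 2: "norm (z * h1 (g z)) < 1" if "norm z < 1" for z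
      using h1z[OF that, of "g z"] g(2)[OF that] that by simp
    show ?thesis
      unfolding \<Phi>_def using holomorphic_on_compose_gen[OF 1 hol(2)] 2
      by (intro holomorphic_intros) (force simp: o_def)
  qed
  have f_hol: "f n holomorphic_on ball 0 1" for n
    by (induction n) (simp_all add: f \<Phi>_hol f_le)
  obtain g r where g: "g holomorphic_on ball 0 1" and r: "strict_mono (r :: nat \<Rightarrow> nat)"
    and lim: "\<And>z. z \<in> ball 0 1 \<Longrightarrow> (\<lambda>n. f (r n) z) \<longlonglongrightarrow> g z"
  proof (rule Montel[of "ball 0 1" "range f" f])
    show "\<exists>B. \<forall>h\<in>range f. \<forall>z\<in>K. norm (h z) \<le> B" if "K \<subseteq> ball 0 1" for K
      using f_le that by (intro exI[of _ 1]) (fastforce intro: order_trans less_imp_le)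
  qed (auto simp: f_hol)
  have g_le: "norm (g z) \<le> norm z" if "norm z < 1" for z
    using tendsto_norm[OF lim[of z]] f_le[OF that] that
    by (intro tendsto_upperbound[OF tendsto_norm[OF lim]]) auto
  \<comment> \<open>Close to the origin one step of the iteration halves the distance of consecutive iterates,
    so there every locally uniform limit of iterates is a fixed point.\<close>
  obtain L1 where L1: "L1 > 0"
    "\<And>x y. norm x \<le> 1/2 \<Longrightarrow> norm y \<le> 1/2 \<Longrightarrow> norm (h1 x - h1 y) \<le> L1 * norm (x - y)"
    using holomorphic_lipschitz_half_disc[OF hol(1)] by blast
  obtain L2 where L2: "L2 > 0"
    "\<And>x y. norm x \<le> 1/2 \<Longrightarrow> norm y \<le> 1/2 \<Longrightarrow> norm (h2 x - h2 y) \<le> L2 * norm (x - y)"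
    using holomorphic_lipschitz_half_disc[OF hol(2)] by blast
  define \<rho> where "\<rho> = min (1/2) (1 / (2 * L1 * L2))"
  have \<rho>: "0 < \<rho>" "\<rho> \<le> 1/2" "\<rho> * L1 * L2 \<le> 1/2"
    using L1(1) L2(1) by (auto simp: \<rho>_def min_def field_simps)
  have fixed_near_0: "g z = \<Phi> z (g z)" if z: "norm z < \<rho>" for z
  proof -
    have z1: "norm z < 1" "norm z \<le> 1/2" using z \<rho> by auto
    have contr: "norm (\<Phi> z x - \<Phi> z y) \<le> 1/2 * norm (x - y)"
      if "norm x \<le> 1/2" "norm y \<le> 1/2" for x y
    proof -
      have "norm (\<Phi> z x - \<Phi> z y) = norm z * norm (h2 (z * h1 x) - h2 (z * h1 y))"
        by (simp add: \<Phi>_def right_diff_distrib[symmetric] norm_mult)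
      also have "\<dots> \<le> 1 * (L2 * norm (z * h1 x - z * h1 y))"
        using L2(2)[of "z * h1 x" "z * h1 y"] h1z[of z x] h1z[of z y] z1 that
        by (intro mult_mono) auto
      also have "\<dots> = L2 * (norm z * norm (h1 x - h1 y))"
        by (simp add: right_diff_distrib[symmetric] norm_mult)
      also have "\<dots> \<le> L2 * (\<rho> * (L1 * norm (x - y)))"
        using L1 L2(1) z that \<rho> by (intro mult_left_mono mult_mono) auto
      also have "\<dots> = (\<rho> * L1 * L2) * norm (x - y)" by simp
      also have "\<dots> \<le> 1/2 * norm (x - y)"
        using \<rho>(3) by (intro mult_right_mono) auto
      finally show ?thesis .
    qed
    have f_half: "norm (f n z) \<le> 1/2" for n
      using f_le[OF z1(1), of n] z1(2) by linarith
    have step: "norm (f (Suc n) z - f n z) \<le> (1/2) ^ n" for n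
    proof (induction n)
      case 0
      then show ?case using f_half[of 1] by (simp add: f)
    next
      case (Suc n)
      have "norm (f (Suc (Suc n)) z - f (Suc n) z) \<le> 1/2 * norm (f (Suc n) z - f n z)"
        using contr[OF f_half f_half, of "Suc n" n] by (simp add: f)
      then show ?case using Suc by simp
    qed
    have "(\<lambda>n. f (Suc n) z - f n z) \<longlonglongrightarrow> 0"
      by (rule Lim_null_comparison[OF always_eventually LIMSEQ_realpow_zero[of "1/2"]])
         (use step in auto)
    then have "(\<lambda>n. f (Suc (r n)) z - f (r n) z) \<longlonglongrightarrow> 0"
      using LIMSEQ_subseq_LIMSEQ[OF _ r] by (fastforce simp: o_def)
    then have "(\<lambda>n. (f (Suc (r n)) z - f (r n) z) + f (r n) z) \<longlonglongrightarrow> 0 + g z"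
      using lim[of z] z1 by (intro tendsto_add) auto
    then have "(\<lambda>n. \<Phi> z (f (r n) z)) \<longlonglongrightarrow> g z"
      by (simp add: f)
    moreover have "(\<lambda>n. \<Phi> z (f (r n) z)) \<longlonglongrightarrow> \<Phi> z (g z)"
    proof (rule Lim_transform_bound[where f = "\<lambda>n. \<Phi> z (f (r n) z) - \<Phi> z (g z)", THEN LIM_zero_cancel])
      have g_half: "norm (g z) \<le> 1/2" using g_le[OF z1(1)] z1(2) by linarith
      have "norm (\<Phi> z (f (r n) z) - \<Phi> z (g z)) \<le> norm (f (r n) z - g z)" for n
        using contr[OF f_half g_half, of "r n"] norm_ge_zero[of "f (r n) z - g z"] by linarith
      then show "\<forall>\<^sub>F n in sequentially. norm (\<Phi> z (f (r n) z) - \<Phi> z (g z)) \<le> norm (f (r n) z - g z)"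
        by simp
      show "(\<lambda>n. f (r n) z - g z) \<longlonglongrightarrow> 0"
        using lim[of z] z1 by (simp add: LIM_zero)
    qed
    ultimately show ?thesis by (rule LIMSEQ_unique)
  qed
  show thesis
  proof (rule that[OF g g_le])
    fix z :: complex assume "norm z < 1"
    moreover have "ball 0 \<rho> \<subseteq> ball (0::complex) 1" using \<rho>(2) by (intro subset_ball) simp
    ultimately show "g z = z * h2 (z * h1 (g z))"
      using analytic_continuation_open[of "ball 0 \<rho>" "ball 0 1" g "\<lambda>z. \<Phi> z (g z)" z]
        \<Phi>_hol[OF g g_le] g fixed_near_0 \<rho>
      by (auto simp: \<Phi>_def)
  qed
qed

section \<open>Resolvents of free unitaries\<close>

definition neumann :: "'a::{real_normed_algebra_1,banach} \<Rightarrow> 'a" where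
  "neumann x = (\<Sum>n. x ^ n)"

lemma neumann_sums:
  fixes x :: "'a::{real_normed_algebra_1,banach}"
  assumes "norm x < 1"
  shows "(\<lambda>n. x ^ n) sums neumann x"
  using complete_algebra_summable_geometric[OF assms] by (simp add: neumann_def summable_sums)

lemma neumann_inverse:
  fixes x :: "'a::{real_normed_algebra_1,banach}"
  assumes "norm x < 1"
  shows "neumann x * (1 - x) = 1" "(1 - x) * neumann x = 1" "x * neumann x = neumann x * x"
proof -
  note sums = neumann_sums[OF assms]
  have "(\<lambda>n. x ^ Suc n) sums (neumann x - 1)"
    using sums sums_Suc_iff[of "\<lambda>n. x ^ n" "neumann x - 1"] by simp
  moreover have "(\<lambda>n. x ^ Suc n) sums (x * neumann x)"
    using sums_mult[OF sums, of x] by simp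
  moreover have "(\<lambda>n. x ^ Suc n) sums (neumann x * x)"
    using sums_mult2[OF sums, of x] by (simp add: power_commutes)
  ultimately have "x * neumann x = neumann x - 1" "neumann x * x = neumann x - 1"
    using sums_unique2 by blast+
  then show "neumann x * (1 - x) = 1" "(1 - x) * neumann x = 1" "x * neumann x = neumann x * x"
    by (simp_all add: right_diff_distrib left_diff_distrib)
qed

lemma norm_neumann_le:
  fixes x :: "'a::{real_normed_algebra_1,banach}"
  assumes "norm x < 1"
  shows "norm (neumann x) \<le> 1 / (1 - norm x)"
proof -
  have "norm (neumann x) \<le> (\<Sum>n. norm x ^ n)"
    unfolding neumann_def using assms
    by (intro norm_suminf_le norm_power_ineq summable_geometric) simp
  then show ?thesis using assms by (simp add: suminf_geometric)
qed

lemma star_algebra_gen_diff_scalar: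
  "x \<in> star_algebra_gen u \<Longrightarrow> x - scaleC c 1 \<in> star_algebra_gen u"
  using star_algebra_gen.add[OF _ star_algebra_gen.scaleC[OF star_algebra_gen.one], of x u "- c"]
  by (simp add: scaleC_minus_left)

lemma star_algebra_gen_power: "x \<in> star_algebra_gen u \<Longrightarrow> x ^ n \<in> star_algebra_gen u"
  by (induction n) (auto intro: star_algebra_gen.intros)

lemma star_algebra_gen_sum:
  fixes f :: "nat \<Rightarrow> 'a::cstar_algebra" and u :: 'a
  assumes "\<And>i. f i \<in> star_algebra_gen u"
  shows "(\<Sum>i<n. f i) \<in> star_algebra_gen u"
proof (induction n)
  case 0
  have "scaleC 0 1 \<in> star_algebra_gen u" by (intro star_algebra_gen.intros)
  then show ?case by simp
qed (auto intro: star_algebra_gen.add assms)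

text \<open>Freeness is a statement about *-polynomials. Resolvents are only limits of them, so they are handled
through the closure.\<close>

lemma neumann_mult_in_closure:
  assumes "norm (scaleC w u) < 1" "y \<in> star_algebra_gen u"
  shows "neumann (scaleC w u) * y \<in> closure (star_algebra_gen u)"
    and "y * neumann (scaleC w u) \<in> closure (star_algebra_gen u)"
proof -
  define S where "S = (\<lambda>n. \<Sum>i<n. scaleC w u ^ i)"
  have S: "S n \<in> star_algebra_gen u" for n
    unfolding S_def by (intro star_algebra_gen_sum star_algebra_gen_power star_algebra_gen.intros)
  have "S \<longlonglongrightarrow> neumann (scaleC w u)"
    using neumann_sums[OF assms(1)] by (simp add: S_def sums_def)
  then have "(\<lambda>n. S n * y) \<longlonglongrightarrow> neumann (scaleC w u) * y"
    and "(\<lambda>n. y * S n) \<longlonglongrightarrow> y * neumann (scaleC w u)"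
    by (rule tendsto_mult[OF _ tendsto_const], rule tendsto_mult[OF tendsto_const])
  moreover have "S n * y \<in> star_algebra_gen u" "y * S n \<in> star_algebra_gen u" for n
    using S assms(2) by (intro star_algebra_gen.mult; simp)+
  ultimately show "neumann (scaleC w u) * y \<in> closure (star_algebra_gen u)"
    and "y * neumann (scaleC w u) \<in> closure (star_algebra_gen u)"
    unfolding closure_sequential by fast+
qed

definition alternating_word :: "'a \<Rightarrow> 'a \<Rightarrow> nat \<Rightarrow> (bool \<times> 'a) list" where
  "alternating_word x y n = concat (replicate n [(True, x), (False, y)])"

lemma alternating_word_props:
  fixes x y :: "'a::monoid_mult"
  shows "prod_list (map snd (alternating_word x y n)) = (x * y) ^ n"
    and "distinct_adj (False # map fst (alternating_word x y n))"
    and "set (alternating_word x y n) \<subseteq> {(True, x), (False, y)}"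
  by (induction n) (auto simp: alternating_word_def mult.assoc)

context cstar_trace
begin

text \<open>The words \<open>(x y)\<^sup>n\<close> alternate, and so do their extensions on the left by a letter of the other kind.\<close>

lemma free_word_trace:
  assumes "star_free \<tau> u v" "x \<in> star_algebra_gen u" "y \<in> star_algebra_gen v" "\<tau> x = 0" "\<tau> y = 0"
  shows "n > 0 \<Longrightarrow> \<tau> ((x * y) ^ n) = 0"
    and "\<tau> (y * (x * y) ^ n) = 0"
    and "x' \<in> star_algebra_gen u \<Longrightarrow> \<tau> x' = 0 \<Longrightarrow> \<tau> (x' * (y * (x * y) ^ n)) = 0"
proof -
  let ?w = "alternating_word x y n"
  have free: "\<tau> (prod_list (map snd w)) = 0"
    if "w \<noteq> []" "distinct_adj (map fst w)"
      "\<And>i a. (i, a) \<in> set w \<Longrightarrow> a \<in> star_algebra_gen (if i then u else v) \<and> \<tau> a = 0" for w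
    using assms(1) that unfolding star_free_def free_family_def by fast
  note props = alternating_word_props[of x y n]
  note adj = props(2)
  have mem: "(True, a) \<in> set ?w \<Longrightarrow> a \<in> star_algebra_gen u \<and> \<tau> a = 0"
    "(False, a) \<in> set ?w \<Longrightarrow> a \<in> star_algebra_gen v \<and> \<tau> a = 0" for a
    using props(3) assms by auto
  have "\<tau> (prod_list (map snd ((False, y) # ?w))) = 0"
    by (rule free) (use adj assms(2-5) mem in \<open>auto split: if_splits\<close>)
  then show "\<tau> (y * (x * y) ^ n) = 0" by (simp add: props(1))
  show "\<tau> (x' * (y * (x * y) ^ n)) = 0" if "x' \<in> star_algebra_gen u" "\<tau> x' = 0"
  proof -
    have "\<tau> (prod_list (map snd ((True, x') # (False, y) # ?w))) = 0"
      by (rule free) (use adj assms(2-5) mem that in \<open>auto split: if_splits\<close>)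
    then show ?thesis by (simp add: props(1))
  qed
  assume "n > 0"
  then have "?w \<noteq> []" by (cases n) (auto simp: alternating_word_def)
  moreover have "distinct_adj (map fst ?w)"
    using adj by (cases "map fst ?w") auto
  ultimately have "\<tau> (prod_list (map snd ?w)) = 0"
    by (intro free) (use mem in \<open>auto split: if_splits\<close>)
  then show "\<tau> ((x * y) ^ n) = 0" by (simp add: props(1))
qed

text \<open>By traciality the last factor moves to the front. The only word that does not alternate then is
\<open>x (x y)\<^sup>n\<close>; there \<open>x * x\<close> splits into a multiple of 1 and a centred element of the same algebra,
and both parts leave alternating words.\<close>

lemma free_alternating_trace:
  assumes "star_free \<tau> u v" "x \<in> star_algebra_gen u" "y \<in> star_algebra_gen v" "\<tau> x = 0" "\<tau> y = 0"
  shows "\<tau> ((1 + scaleC b y) * (x * y) ^ n * (1 + scaleC a x)) = (if n = 0 then 1 else 0)"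
proof -
  note word = free_word_trace[OF assms]
  have x: "\<tau> (x * (x * y) ^ n) = 0"
  proof (cases n)
    case (Suc m)
    define c where "c = \<tau> (x * x)"
    define x' where "x' = x * x - scaleC c 1"
    have "x' \<in> star_algebra_gen u"
      unfolding x'_def by (intro star_algebra_gen_diff_scalar star_algebra_gen.mult assms)
    moreover have "\<tau> x' = 0" by (simp add: x'_def trace_diff trace_scaleC c_def)
    ultimately have "\<tau> (x' * (y * (x * y) ^ m)) = 0" by (rule word(3))
    moreover have "x * (x * y) ^ n = x' * (y * (x * y) ^ m) + scaleC c (y * (x * y) ^ m)"
      by (simp add: x'_def Suc left_diff_distrib mult_scaleC_left mult.assoc)
    ultimately show ?thesis by (simp add: trace_add trace_scaleC word(2))
  qed (simp add: assms)
  have "\<tau> ((1 + scaleC b y) * (x * y) ^ n * (1 + scaleC a x))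
      = \<tau> ((1 + scaleC a x) * ((1 + scaleC b y) * (x * y) ^ n))"
    by (rule trace_commute)
  also have "(1 + scaleC a x) * ((1 + scaleC b y) * (x * y) ^ n)
      = (x * y) ^ n + scaleC b (y * (x * y) ^ n) + scaleC a (x * (x * y) ^ n)
        + scaleC (a * b) ((x * y) ^ Suc n)"
    by (simp add: distrib_left distrib_right mult_scaleC_left mult_scaleC_right scaleC_add_right
        scaleC_scaleC mult.assoc add.assoc mult.commute[of a b])
  also have "\<tau> \<dots> = \<tau> ((x * y) ^ n)"
    using word(1)[of "Suc n"] by (simp add: trace_add trace_scaleC word(2) x)
  also have "\<dots> = (if n = 0 then 1 else 0)"
    using word(1)[of n] by auto
  finally show ?thesis .
qed

lemma centred_approximation:
  assumes "x \<in> closure (star_algebra_gen u)" "\<tau> x = 0"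
  obtains s where "\<And>k. s k \<in> star_algebra_gen u" "\<And>k. \<tau> (s k) = 0" "s \<longlonglongrightarrow> x"
proof -
  obtain r where r: "\<And>k. r k \<in> star_algebra_gen u" "r \<longlonglongrightarrow> x"
    using assms(1) unfolding closure_sequential by blast
  have "(\<lambda>k. \<tau> (r k)) \<longlonglongrightarrow> 0"
    using bounded_linear.tendsto[OF bounded_linear_trace r(2)] assms(2) by simp
  then have "(\<lambda>k. scaleC (\<tau> (r k)) (1::'a)) \<longlonglongrightarrow> 0"
    by (subst tendsto_norm_zero_iff[symmetric]) (simp add: norm_scaleC tendsto_norm_zero)
  from tendsto_diff[OF r(2) this] have "(\<lambda>k. r k - scaleC (\<tau> (r k)) 1) \<longlonglongrightarrow> x" by simp
  moreover have "\<tau> (r k - scaleC (\<tau> (r k)) 1) = 0" for k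
    by (simp add: trace_diff trace_scaleC)
  ultimately show thesis
    by (intro that[of "\<lambda>k. r k - scaleC (\<tau> (r k)) 1"] star_algebra_gen_diff_scalar r(1))
qed

lemma free_alternating_trace_closure:
  assumes "star_free \<tau> u v" "x \<in> closure (star_algebra_gen u)" "y \<in> closure (star_algebra_gen v)"
    "\<tau> x = 0" "\<tau> y = 0"
  shows "\<tau> ((1 + scaleC b y) * (x * y) ^ n * (1 + scaleC a x)) = (if n = 0 then 1 else 0)"
proof -
  obtain s where s: "\<And>k. s k \<in> star_algebra_gen u" "\<And>k. \<tau> (s k) = 0" "s \<longlonglongrightarrow> x"
    using centred_approximation[OF assms(2,4)] by blast
  obtain t where t: "\<And>k. t k \<in> star_algebra_gen v" "\<And>k. \<tau> (t k) = 0" "t \<longlonglongrightarrow> y"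
    using centred_approximation[OF assms(3,5)] by blast
  note tendsto = bounded_linear.tendsto[OF bounded_linear_trace]
    bounded_linear.tendsto[OF bounded_linear_scaleC]
  have "(\<lambda>k. \<tau> ((1 + scaleC b (t k)) * (s k * t k) ^ n * (1 + scaleC a (s k))))
      \<longlonglongrightarrow> \<tau> ((1 + scaleC b y) * (x * y) ^ n * (1 + scaleC a x))"
    by (intro tendsto tendsto_intros s t)
  then show ?thesis
    using free_alternating_trace[OF assms(1) s(1) t(1) s(2) t(2)]
    by (simp add: LIMSEQ_const_iff)
qed

lemma free_neumann_trace:
  assumes "star_free \<tau> u v" "x \<in> closure (star_algebra_gen u)" "y \<in> closure (star_algebra_gen v)"
    "\<tau> x = 0" "\<tau> y = 0" and z: "norm (scaleC z (x * y)) < 1"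
  shows "\<tau> ((1 + scaleC b y) * neumann (scaleC z (x * y)) * (1 + scaleC a x)) = 1"
proof -
  let ?f = "\<lambda>n. \<tau> ((1 + scaleC b y) * scaleC z (x * y) ^ n * (1 + scaleC a x))"
  have "?f sums \<tau> ((1 + scaleC b y) * neumann (scaleC z (x * y)) * (1 + scaleC a x))"
    by (intro bounded_linear.sums[OF bounded_linear_trace] sums_mult sums_mult2 neumann_sums z)
  moreover have "?f n = (if n = 0 then 1 else 0)" for n
    using free_alternating_trace_closure[OF assms(1-5), of b n a]
    by (simp add: power_scaleC mult_scaleC_left mult_scaleC_right trace_scaleC)
  then have "?f sums 1"
    using sums_single[of 0 "\<lambda>_. 1::complex"] by simp
  ultimately show ?thesis by (rule sums_unique2)
qed

end

section \<open>Subordination\<close>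

locale unitary_law = cstar_trace \<tau> + circle_law M
  for \<tau> :: "'a::cstar_algebra \<Rightarrow> complex" and u :: 'a and M +
  assumes unitary: "unitary u" and distr: "has_distribution \<tau> u M"
begin

lemma norm_scaled: "norm (scaleC w u) = norm w"
  by (simp add: norm_scaleC norm_unitary[OF unitary])

lemma moments: "\<tau> (u ^ n) = (\<integral>t. t ^ n \<partial>M)"
  using distr by (simp add: has_distribution_def)

lemma trace_resolvent:
  assumes "norm w < 1"
  shows "\<tau> (neumann (scaleC w u)) = mgf M w"
    and "\<tau> (neumann (scaleC w u) * u) = shifted_mgf M w"
proof -
  have sums: "(\<lambda>n. scaleC w u ^ n) sums neumann (scaleC w u)"
    using assms by (intro neumann_sums) (simp add: norm_scaled)
  have "(\<lambda>n. \<tau> (scaleC w u ^ n)) sums \<tau> (neumann (scaleC w u))"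
    by (rule bounded_linear.sums[OF bounded_linear_trace sums])
  moreover have "\<tau> (scaleC w u ^ n) = (\<integral>t. 1 * t ^ n \<partial>M) * w ^ n" for n
    by (simp add: power_scaleC trace_scaleC moments)
  ultimately show "\<tau> (neumann (scaleC w u)) = mgf M w"
    using circle_transform_sums[OF assms, of "\<lambda>_. 1"] sums_unique2
    by (fastforce simp: mgf_def)
  have "(\<lambda>n. \<tau> (scaleC w u ^ n * u)) sums \<tau> (neumann (scaleC w u) * u)"
    by (intro bounded_linear.sums[OF bounded_linear_trace] sums_mult2 sums)
  moreover have "\<tau> (scaleC w u ^ n * u) = (\<integral>t. t * t ^ n \<partial>M) * w ^ n" for n
    using moments[of "Suc n"] by (simp add: power_scaleC mult_scaleC_left trace_scaleC power_commutes)
  ultimately show "\<tau> (neumann (scaleC w u) * u) = shifted_mgf M w"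
    using circle_transform_sums[OF assms, of "\<lambda>t. t"] sums_unique2
    by (fastforce simp: shifted_mgf_def)
qed

text \<open>The resolvent of \<open>w u\<close>, normalised to trace 1, is 1 plus \<open>w\<close> times this element. Without the factor
\<open>w\<close> it remains meaningful at \<open>w = 0\<close>, where the normalised resolvent is constant.\<close>

definition centred :: "complex \<Rightarrow> 'a" where
  "centred w = neumann (scaleC w u) * (u - scaleC (eta_quotient M w) 1)"

context
  fixes w :: complex
  assumes w: "norm w < 1"
begin

lemma centred_commute: "centred w = (u - scaleC (eta_quotient M w) 1) * neumann (scaleC w u)"
proof -
  have inv: "neumann (scaleC w u) * (1 - scaleC w u) = 1" "(1 - scaleC w u) * neumann (scaleC w u) = 1"
    using neumann_inverse[of "scaleC w u"] w by (simp_all add: norm_scaled)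
  have "u * (1 - scaleC w u) = (1 - scaleC w u) * u"
    by (simp add: right_diff_distrib left_diff_distrib mult_scaleC_left mult_scaleC_right)
  then have "neumann (scaleC w u) * (u * (1 - scaleC w u)) * neumann (scaleC w u)
      = neumann (scaleC w u) * ((1 - scaleC w u) * u) * neumann (scaleC w u)" by simp
  also have "\<dots> = (neumann (scaleC w u) * (1 - scaleC w u)) * (u * neumann (scaleC w u))"
    by (simp only: mult.assoc)
  also have "neumann (scaleC w u) * (u * (1 - scaleC w u)) * neumann (scaleC w u)
      = neumann (scaleC w u) * u * ((1 - scaleC w u) * neumann (scaleC w u))"
    by (simp only: mult.assoc)
  finally have "neumann (scaleC w u) * u = u * neumann (scaleC w u)"
    by (simp only: inv mult_1_left mult_1_right)
  then show ?thesis
    by (simp add: centred_def right_diff_distrib left_diff_distrib mult_scaleC_left mult_scaleC_right)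
qed

lemma centred_in_closure: "centred w \<in> closure (star_algebra_gen u)"
  unfolding centred_def using w
  by (intro neumann_mult_in_closure star_algebra_gen_diff_scalar star_algebra_gen.gen)
     (simp add: norm_scaled)

lemma trace_centred: "\<tau> (centred w) = 0"
  using trace_resolvent[OF w] mgf_nonzero[OF w]
  by (simp add: centred_def right_diff_distrib mult_scaleC_right trace_diff trace_scaleC eta_quotient_def)

lemma norm_centred_le: "norm (centred w) \<le> 2 / (1 - norm w)"
proof -
  have "norm (centred w) \<le> norm (neumann (scaleC w u)) * norm (u - scaleC (eta_quotient M w) 1)"
    unfolding centred_def by (rule norm_mult_ineq)
  also have "\<dots> \<le> (1 / (1 - norm w)) * (1 + 1)"
  proof (rule mult_mono)
    show "norm (neumann (scaleC w u)) \<le> 1 / (1 - norm w)"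
      using norm_neumann_le[of "scaleC w u"] w by (simp add: norm_scaled)
    show "norm (u - scaleC (eta_quotient M w) 1) \<le> 1 + 1"
      using norm_triangle_ineq4[of u "scaleC (eta_quotient M w) 1"] norm_eta_quotient_le[OF w]
      by (simp add: norm_scaleC norm_unitary[OF unitary])
  qed (use w in auto)
  finally show ?thesis by simp
qed

lemma neumann_eq_centred:
  "neumann (scaleC w u) = scaleC (mgf M w) (1 + scaleC w (centred w))"
proof -
  let ?R = "neumann (scaleC w u)" and ?p = "eta_quotient M w"
  have inv: "?R * (1 - scaleC w u) = 1"
    using neumann_inverse[of "scaleC w u"] w by (simp add: norm_scaled)
  have "1 + scaleC w (centred w) = ?R * (1 - scaleC w u) + ?R * scaleC w (u - scaleC ?p 1)"
    by (simp add: inv centred_def mult_scaleC_right)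
  also have "\<dots> = scaleC (1 - w * ?p) ?R"
    by (simp add: right_diff_distrib scaleC_diff_right mult_scaleC_right scaleC_scaleC
        scaleC_diff_left)
  also have "1 - w * ?p = 1 / mgf M w" by (simp add: eta_eq[OF w])
  finally show ?thesis using mgf_nonzero[OF w] by (simp add: scaleC_scaleC)
qed

end

end

text \<open>With the subordination equations in force, the cross terms cancel and the mixed expression on the
left collapses to a multiple of the resolvent denominator of the product.\<close>

lemma free_product_factorization:
  fixes u v :: "'a::cstar_algebra"
  assumes "s = z * q" "t = z * p"
  shows "(1 - scaleC s u) * (1 - scaleC t v) - scaleC z ((u - scaleC p 1) * (v - scaleC q 1))
    = scaleC (1 - z * p * q) (1 - scaleC z (u * v))"
  by (simp add: assms right_diff_distrib left_diff_distrib mult_scaleC_left mult_scaleC_right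
      scaleC_diff_right scaleC_diff_left scaleC_add_right scaleC_scaleC algebra_simps)

text \<open>The functions \<open>\<omega>1\<close>, \<open>\<omega>2\<close> solve \<open>\<omega>1 = z q\<close> and \<open>\<omega>2 = z p\<close>, where \<open>p\<close> and \<open>q\<close> are the \<open>\<eta>\<close>-quotients of
the two laws at \<open>\<omega>1\<close> and \<open>\<omega>2\<close>; consequently the two \<open>\<eta>\<close>-transforms agree there, with value \<open>z p q\<close>.
For small \<open>z\<close>, multiplying the factorization above by the resolvents of \<open>\<omega>1 u\<close> and \<open>\<omega>2 v\<close> writes
the resolvent of \<open>z u v\<close> as a Neumann series in the product of two free centred elements. Every term
of it except the first has trace 0, so the transform of the product is \<open>1 / (1 - z p q)\<close>. Analytic
continuation extends this to the disc.\<close>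

theorem subordination:
  fixes \<tau> :: "'a::cstar_algebra \<Rightarrow> complex"
  assumes "unitary_law \<tau> u M1" "unitary_law \<tau> v M2" "unitary_law \<tau> (u * v) M"
    and free: "star_free \<tau> u v"
  obtains \<omega>1 \<omega>2 where "\<And>z. norm z < 1 \<Longrightarrow> norm (\<omega>1 z) < 1" "\<And>z. norm z < 1 \<Longrightarrow> norm (\<omega>2 z) < 1"
    "\<And>z. norm z < 1 \<Longrightarrow> mgf M1 (\<omega>1 z) = mgf M z" "\<And>z. norm z < 1 \<Longrightarrow> mgf M2 (\<omega>2 z) = mgf M z"
    "\<And>z. norm z < 1 \<Longrightarrow> \<omega>1 z * \<omega>2 z = z * (1 - 1 / mgf M z)"
proof -
  interpret U: unitary_law \<tau> u M1 by fact
  interpret V: unitary_law \<tau> v M2 by fact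
  interpret UV: unitary_law \<tau> "u * v" M by fact
  obtain \<omega>1 where hol1: "\<omega>1 holomorphic_on ball 0 1"
    and le1: "\<And>z. norm z < 1 \<Longrightarrow> norm (\<omega>1 z) \<le> norm z"
    and fixed: "\<And>z. norm z < 1 \<Longrightarrow> \<omega>1 z = z * eta_quotient M2 (z * eta_quotient M1 (\<omega>1 z))"
    using holomorphic_fixed_point[OF U.eta_quotient_holomorphic V.eta_quotient_holomorphic
        U.norm_eta_quotient_le V.norm_eta_quotient_le] by blast
  define p where "p = (\<lambda>z. eta_quotient M1 (\<omega>1 z))"
  define \<omega>2 where "\<omega>2 = (\<lambda>z. z * p z)"
  define q where "q = (\<lambda>z. eta_quotient M2 (\<omega>2 z))"
  have lt1: "norm (\<omega>1 z) < 1" if "norm z < 1" for z using le1[OF that] that by simp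
  have le2: "norm (\<omega>2 z) \<le> norm z" if "norm z < 1" for z
    using mult_left_le[OF U.norm_eta_quotient_le[OF lt1[OF that]], of "norm z"]
    by (simp add: \<omega>2_def p_def norm_mult)
  have lt2: "norm (\<omega>2 z) < 1" if "norm z < 1" for z using le2[OF that] that by simp
  have \<omega>1: "\<omega>1 z = z * q z" if "norm z < 1" for z
    using fixed[OF that] by (simp add: q_def \<omega>2_def p_def)
  have eta1: "z * p z * q z = 1 - 1 / mgf M1 (\<omega>1 z)" if "norm z < 1" for z
    using U.eta_eq[OF lt1[OF that]] \<omega>1[OF that] by (simp add: p_def mult_ac)
  have eta2: "z * p z * q z = 1 - 1 / mgf M2 (\<omega>2 z)" if "norm z < 1" for z
    using V.eta_eq[OF lt2[OF that]] by (simp add: q_def \<omega>2_def mult_ac)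
  have eq12: "mgf M1 (\<omega>1 z) = mgf M2 (\<omega>2 z)" if "norm z < 1" for z
    using eta1[OF that] eta2[OF that] by simp
  \<comment> \<open>The centred elements have norm at most 4 when \<open>\<omega>1\<close> and \<open>\<omega>2\<close> lie in the disc of radius 1/2,
    so the Neumann series converges for \<open>norm z < 1 / 16\<close>.\<close>
  have near_0: "mgf M z = mgf M1 (\<omega>1 z)" if z: "norm z < 1 / 16" for z
  proof -
    let ?G = "mgf M1 (\<omega>1 z)"
    have z1: "norm z < 1" using z by simp
    note lt = lt1[OF z1] lt2[OF z1]
    define R1 where "R1 = neumann (scaleC (\<omega>1 z) u)"
    define R2 where "R2 = neumann (scaleC (\<omega>2 z) v)"
    define D1 where "D1 = 1 - scaleC (\<omega>1 z) u"
    define D2 where "D2 = 1 - scaleC (\<omega>2 z) v"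
    define a where "a = U.centred (\<omega>1 z)"
    define b where "b = V.centred (\<omega>2 z)"
    define N where "N = neumann (scaleC z (a * b))"
    define W where "W = neumann (scaleC z (u * v))"
    have inv1: "R1 * D1 = 1" "D1 * R1 = 1"
      using neumann_inverse[of "scaleC (\<omega>1 z) u"] lt by (simp_all add: R1_def D1_def U.norm_scaled)
    have inv2: "R2 * D2 = 1" "D2 * R2 = 1"
      using neumann_inverse[of "scaleC (\<omega>2 z) v"] lt by (simp_all add: R2_def D2_def V.norm_scaled)
    have "norm a \<le> 4" "norm b \<le> 4"
    proof -
      have "2 / (1 - norm (\<omega>1 z)) \<le> 4" "2 / (1 - norm (\<omega>2 z)) \<le> 4"
        using le1[OF z1] le2[OF z1] z by (simp_all add: field_simps)
      then show "norm a \<le> 4" "norm b \<le> 4"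
        using U.norm_centred_le[OF lt(1)] V.norm_centred_le[OF lt(2)] by (simp_all add: a_def b_def)
    qed
    then have "norm (a * b) \<le> 4 * 4"
      using norm_mult_ineq[of a b] mult_mono[of "norm a" 4 "norm b" 4] by simp
    then have small: "norm (scaleC z (a * b)) < 1"
      using z mult_left_mono[of "norm (a * b)" 16 "norm z"] by (simp add: norm_scaleC)
    have N: "(1 - scaleC z (a * b)) * N = 1"
      using neumann_inverse[OF small] by (simp add: N_def)
    have W: "W * (1 - scaleC z (u * v)) = 1"
      using neumann_inverse[of "scaleC z (u * v)"] z1 by (simp add: W_def UV.norm_scaled)
    have Da: "D1 * a = u - scaleC (p z) 1"
      using inv1 by (simp add: a_def U.centred_def R1_def[symmetric] p_def mult.assoc[symmetric])
    have bD: "b * D2 = v - scaleC (q z) 1"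
      using inv2 V.centred_commute[OF lt(2)] by (simp add: b_def R2_def[symmetric] q_def mult.assoc)
    have "D1 * (1 - scaleC z (a * b)) * D2 = D1 * D2 - scaleC z ((D1 * a) * (b * D2))"
      by (simp add: right_diff_distrib left_diff_distrib mult_scaleC_left mult_scaleC_right mult.assoc)
    also have "\<dots> = scaleC (1 - z * p z * q z) (1 - scaleC z (u * v))"
      unfolding Da bD unfolding D1_def D2_def
      by (rule free_product_factorization) (use \<omega>1[OF z1] in \<open>simp_all add: \<omega>2_def\<close>)
    also have "1 - z * p z * q z = 1 / ?G" by (simp add: eta1[OF z1])
    finally have fact: "scaleC (1 / ?G) (1 - scaleC z (u * v)) = D1 * (1 - scaleC z (a * b)) * D2" ..
    have "scaleC (1 / ?G) (1 - scaleC z (u * v)) * (R2 * N * R1)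
        = D1 * ((1 - scaleC z (a * b)) * ((D2 * R2) * N)) * R1"
      unfolding fact by (simp add: mult.assoc)
    also have "\<dots> = 1" by (simp add: inv1 inv2 N)
    finally have "W * (scaleC (1 / ?G) (1 - scaleC z (u * v)) * (R2 * N * R1)) = W" by simp
    moreover have "W * (scaleC (1 / ?G) (1 - scaleC z (u * v)) * (R2 * N * R1))
        = scaleC (1 / ?G) ((W * (1 - scaleC z (u * v))) * (R2 * N * R1))"
      by (simp add: mult_scaleC_left mult_scaleC_right mult.assoc)
    ultimately have "W = scaleC (1 / ?G) (R2 * N * R1)" by (simp add: W)
    moreover have "R1 = scaleC ?G (1 + scaleC (\<omega>1 z) a)"
      using U.neumann_eq_centred[OF lt(1)] by (simp add: R1_def a_def)
    moreover have "R2 = scaleC ?G (1 + scaleC (\<omega>2 z) b)"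
      using V.neumann_eq_centred[OF lt(2)] by (simp add: R2_def b_def eq12[OF z1])
    ultimately have "W = scaleC ?G ((1 + scaleC (\<omega>2 z) b) * N * (1 + scaleC (\<omega>1 z) a))"
      using U.mgf_nonzero[OF lt(1)] by (simp add: mult_scaleC_left mult_scaleC_right scaleC_scaleC)
    moreover have "\<tau> ((1 + scaleC (\<omega>2 z) b) * N * (1 + scaleC (\<omega>1 z) a)) = 1"
      unfolding N_def
      by (rule U.free_neumann_trace[OF free _ _ _ _ small])
         (simp_all add: a_def b_def lt U.centred_in_closure V.centred_in_closure
           U.trace_centred V.trace_centred)
    ultimately show ?thesis
      using UV.trace_resolvent(1)[OF z1] by (simp add: W_def U.trace_scaleC)
  qed
  have eq: "mgf M z = mgf M1 (\<omega>1 z)" if z: "norm z < 1" for z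
  proof (rule analytic_continuation_open[of "ball 0 (1 / 16)" "ball 0 1" "mgf M" "\<lambda>z. mgf M1 (\<omega>1 z)"])
    show "(\<lambda>z. mgf M1 (\<omega>1 z)) holomorphic_on ball 0 1"
      using holomorphic_on_compose_gen[OF hol1 U.mgf_holomorphic] lt1 by (force simp: o_def)
  qed (use near_0 z UV.mgf_holomorphic in auto)
  show thesis
  proof (rule that[OF lt1 lt2])
    fix z :: complex assume z: "norm z < 1"
    show "mgf M1 (\<omega>1 z) = mgf M z" "mgf M2 (\<omega>2 z) = mgf M z"
      using eq[OF z] eq12[OF z] by simp_all
    show "\<omega>1 z * \<omega>2 z = z * (1 - 1 / mgf M z)"
      using eta1[OF z] \<omega>1[OF z] eq[OF z] by (simp add: \<omega>2_def) (metis mult.assoc mult.commute)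
  qed
qed

section \<open>Singularities of the subordinated moment generating function\<close>

text \<open>The Poisson integral \<open>2 * Re G - 1\<close> is \<open>1 - (norm w)\<^sup>2\<close> times the energy, and it is also
\<open>(norm G)\<^sup>2\<close> times \<open>1 - (norm (1 - 1 / G))\<^sup>2\<close>. The last factor depends on the value of the transform
alone, so it is shared by a law and the laws it is subordinate to.\<close>

lemma (in circle_law) concentration_identity:
  assumes "norm w < 1"
  shows "1 - (norm w)\<^sup>2 = concentration M w * (1 - (norm (1 - 1 / mgf M w))\<^sup>2)"
proof -
  let ?G = "mgf M w"
  have nz: "?G \<noteq> 0" by (rule mgf_nonzero[OF assms])
  have I: "energy M w > 0" using energy_ge[OF assms] by simp
  have "1 - 1 / ?G = (?G - 1) / ?G" using nz by (simp add: diff_divide_distrib)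
  then have "(norm (1 - 1 / ?G))\<^sup>2 * (norm ?G)\<^sup>2 = (norm (?G - 1))\<^sup>2"
    using nz by (simp add: norm_divide power_divide)
  moreover have "(norm (?G - 1))\<^sup>2 = (norm ?G)\<^sup>2 - (2 * Re ?G - 1)"
    unfolding cmod_power2 by (simp add: power2_eq_square algebra_simps)
  ultimately have "(1 - (norm (1 - 1 / ?G))\<^sup>2) * (norm ?G)\<^sup>2 = (1 - (norm w)\<^sup>2) * energy M w"
    using Re_mgf[OF assms] by (simp add: left_diff_distrib)
  then show ?thesis
    using I by (simp add: concentration_def field_simps)
qed

locale subordinate_laws = fst: circle_law M1 + snd: circle_law M2 + circle_law M
  for M1 M2 M +
  fixes \<omega>1 \<omega>2 :: "complex \<Rightarrow> complex"
  assumes \<omega>_less: "norm z < 1 \<Longrightarrow> norm (\<omega>1 z) < 1" "norm z < 1 \<Longrightarrow> norm (\<omega>2 z) < 1"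
    and mgf_\<omega>: "norm z < 1 \<Longrightarrow> mgf M1 (\<omega>1 z) = mgf M z" "norm z < 1 \<Longrightarrow> mgf M2 (\<omega>2 z) = mgf M z"
    and \<omega>_prod: "norm z < 1 \<Longrightarrow> \<omega>1 z * \<omega>2 z = z * (1 - 1 / mgf M z)"
begin

text \<open>Write \<open>s\<close> for the common value of \<open>1 - (norm (1 - 1 / mgf))\<^sup>2\<close> and \<open>Q\<close>, \<open>Q1\<close>, \<open>Q2\<close> for the three
concentrations. The identity above gives the squared moduli of \<open>z\<close>, \<open>\<omega>1 z\<close>, \<open>\<omega>2 z\<close> as \<open>1 - Q s\<close>,
\<open>1 - Q1 s\<close>, \<open>1 - Q2 s\<close>, and the product relation becomes
\<open>(1 - Q1 s) (1 - Q2 s) = (1 - Q s) (1 - s)\<close>. Dividing the difference by \<open>s\<close> leaves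
\<open>Q = Q1 + Q2 - (1 - Q s) - Q1 Q2 s\<close>.\<close>

lemma concentration_le:
  assumes z: "norm z < 1"
  shows "concentration M z \<le> concentration M1 (\<omega>1 z) + concentration M2 (\<omega>2 z) - (norm z)\<^sup>2"
proof -
  define s where "s = 1 - (norm (1 - 1 / mgf M z))\<^sup>2"
  define Q where "Q = concentration M z"
  define Q1 where "Q1 = concentration M1 (\<omega>1 z)"
  define Q2 where "Q2 = concentration M2 (\<omega>2 z)"
  have id: "1 - (norm z)\<^sup>2 = Q * s" "1 - (norm (\<omega>1 z))\<^sup>2 = Q1 * s" "1 - (norm (\<omega>2 z))\<^sup>2 = Q2 * s"
    using concentration_identity[OF z] fst.concentration_identity[OF \<omega>_less(1)[OF z]]
      snd.concentration_identity[OF \<omega>_less(2)[OF z]] mgf_\<omega>[OF z]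
    by (simp_all add: s_def Q_def Q1_def Q2_def)
  have Q: "Q1 > 0" "Q2 > 0"
    using fst.concentration_pos[OF \<omega>_less(1)[OF z]] snd.concentration_pos[OF \<omega>_less(2)[OF z]]
    by (auto simp: Q1_def Q2_def)
  have "s > 0"
    using norm_eta_less_1[OF z] by (simp add: s_def abs_square_less_1)
  have "(norm (\<omega>1 z))\<^sup>2 * (norm (\<omega>2 z))\<^sup>2 = (norm z)\<^sup>2 * (1 - s)"
    using arg_cong[OF \<omega>_prod[OF z], of "\<lambda>x. (norm x)\<^sup>2"]
    by (simp add: norm_mult power_mult_distrib s_def)
  moreover have "(norm (\<omega>1 z))\<^sup>2 = 1 - Q1 * s" "(norm (\<omega>2 z))\<^sup>2 = 1 - Q2 * s" "(norm z)\<^sup>2 = 1 - Q * s"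
    using id by simp_all
  ultimately have "(1 - Q1 * s) * (1 - Q2 * s) = (1 - Q * s) * (1 - s)" by simp
  then have "s * (Q1 + Q2 - 1 + Q * s - Q - Q1 * Q2 * s) = 0" by algebra
  then have "Q = Q1 + Q2 - (1 - Q * s) - Q1 * Q2 * s"
    using \<open>s > 0\<close> by simp
  moreover have "0 \<le> Q1 * Q2 * s" using Q \<open>s > 0\<close> by simp
  moreover have "(norm z)\<^sup>2 = 1 - Q * s" using id(1) by simp
  ultimately show ?thesis by (simp add: Q_def Q1_def Q2_def)
qed

text \<open>The points of the circle at which the transform of the convolution may be unbounded.\<close>

definition heavy :: "complex set" where
  "heavy = {\<xi>1 * \<xi>2 | \<xi>1 \<xi>2. \<xi>1 \<in> unit_circle \<and> \<xi>2 \<in> unit_circle \<and>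
     1 \<le> measure M1 {cnj \<xi>1} + measure M2 {cnj \<xi>2}}"

text \<open>Along a suitable subsequence \<open>Z\<close>, \<open>\<omega>1 \<circ> Z\<close> and \<open>\<omega>2 \<circ> Z\<close> converge, and the limits lie on the circle
because all three transforms blow up. The \<open>\<eta>\<close>-transform tends to 1, so the limits multiply to the
limit of \<open>Z\<close>. The estimate is \<open>concentration_le\<close> combined with the limiting bound of the two
concentrations by atoms.\<close>

lemma singularity:
  assumes Z: "\<And>n. norm (Z n) < 1" and inf: "filterlim (\<lambda>n. norm (mgf M (Z n))) at_top sequentially"
  obtains r \<xi>1 \<xi>2 where "strict_mono (r :: nat \<Rightarrow> nat)" "norm \<xi>1 = 1" "norm \<xi>2 = 1"
    "(Z \<circ> r) \<longlonglongrightarrow> \<xi>1 * \<xi>2"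
    "\<And>e. e > 0 \<Longrightarrow> \<forall>\<^sub>F n in sequentially. concentration M (Z (r n))
        < measure M1 {cnj \<xi>1} + measure M2 {cnj \<xi>2} - 1 + e"
proof -
  let ?S = "cball (0::complex) 1 \<times> cball (0::complex) 1 \<times> cball (0::complex) 1"
  have "seq_compact ?S"
    by (intro compact_imp_seq_compact compact_Times compact_cball)
  moreover have "\<forall>n. (\<omega>1 (Z n), \<omega>2 (Z n), Z n) \<in> ?S"
    using Z \<omega>_less by (auto simp: less_imp_le)
  ultimately obtain l r where r: "strict_mono (r :: nat \<Rightarrow> nat)"
    and l: "((\<lambda>n. (\<omega>1 (Z n), \<omega>2 (Z n), Z n)) \<circ> r) \<longlonglongrightarrow> l"
    by (rule seq_compactE)
  define Y where "Y = Z \<circ> r"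
  define \<xi>1 where "\<xi>1 = fst l"
  define \<xi>2 where "\<xi>2 = fst (snd l)"
  define \<zeta> where "\<zeta> = snd (snd l)"
  have Y: "norm (Y n) < 1" for n by (simp add: Y_def Z)
  have lim: "(\<lambda>n. \<omega>1 (Y n)) \<longlonglongrightarrow> \<xi>1" "(\<lambda>n. \<omega>2 (Y n)) \<longlonglongrightarrow> \<xi>2" "Y \<longlonglongrightarrow> \<zeta>"
    using tendsto_fst[OF l] tendsto_fst[OF tendsto_snd[OF l]] tendsto_snd[OF tendsto_snd[OF l]]
    by (simp_all add: o_def Y_def \<xi>1_def \<xi>2_def \<zeta>_def)
  have infY: "filterlim (\<lambda>n. norm (mgf M (Y n))) at_top sequentially"
    using filterlim_compose[OF inf filterlim_subseq[OF r]] by (simp add: Y_def)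
  have inv0: "(\<lambda>n. inverse (norm (mgf M (Y n)))) \<longlonglongrightarrow> 0"
    by (rule tendsto_inverse_0_at_top[OF infY])
  \<comment> \<open>A sequence on which a transform blows up runs to the circle, since transforms are bounded on
    compact parts of the disc.\<close>
  have boundary: "norm \<xi> = 1"
    if N: "circle_law N" and W: "\<And>n. norm (W n) < 1" "W \<longlonglongrightarrow> \<xi>" "\<And>n. mgf N (W n) = mgf M (Y n)" for N W \<xi>
  proof -
    interpret N: circle_law N by fact
    have "1 - norm (W n) \<le> inverse (norm (mgf M (Y n)))" for n
      using N.norm_mgf_le[OF W(1)[of n]] W(1)[of n] N.mgf_nonzero[OF W(1)[of n]] W(3)[of n]
      by (simp add: field_simps)
    then have "(\<lambda>n. 1 - norm (W n)) \<longlonglongrightarrow> 0"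
      using W(1) by (intro tendsto_sandwich[OF _ _ tendsto_const inv0]) (auto simp: less_imp_le)
    moreover have "(\<lambda>n. 1 - norm (W n)) \<longlonglongrightarrow> 1 - norm \<xi>"
      by (intro tendsto_intros W)
    ultimately have "0 = 1 - norm \<xi>" by (rule LIMSEQ_unique)
    then show ?thesis by simp
  qed
  have \<xi>: "norm \<xi>1 = 1" "norm \<xi>2 = 1" "norm \<zeta> = 1"
    using boundary[OF fst.circle_law_axioms \<omega>_less(1)[OF Y] lim(1) mgf_\<omega>(1)[OF Y]]
      boundary[OF snd.circle_law_axioms \<omega>_less(2)[OF Y] lim(2) mgf_\<omega>(2)[OF Y]]
      boundary[OF circle_law_axioms Y lim(3) refl] by auto
  have "(\<lambda>n. 1 / mgf M (Y n)) \<longlonglongrightarrow> 0"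
    using inv0 by (subst tendsto_norm_zero_iff[symmetric]) (simp add: norm_divide inverse_eq_divide)
  then have "(\<lambda>n. Y n * (1 - 1 / mgf M (Y n))) \<longlonglongrightarrow> \<zeta> * (1 - 0)"
    by (intro tendsto_intros lim)
  moreover have "(\<lambda>n. \<omega>1 (Y n) * \<omega>2 (Y n)) \<longlonglongrightarrow> \<xi>1 * \<xi>2"
    by (intro tendsto_intros lim)
  ultimately have \<zeta>: "\<zeta> = \<xi>1 * \<xi>2"
    using \<omega>_prod[OF Y] LIMSEQ_unique by fastforce
  show thesis
  proof (rule that[OF r \<xi>(1,2)])
    show "(Z \<circ> r) \<longlonglongrightarrow> \<xi>1 * \<xi>2" using lim(3) by (simp add: Y_def \<zeta>)
    fix e :: real assume "e > 0"
    then have "e / 3 > 0" by simp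
    have "\<forall>\<^sub>F n in sequentially. concentration M1 (\<omega>1 (Y n)) < measure M1 {cnj \<xi>1} + e / 3"
      using fst.concentration_at_singularity[OF \<omega>_less(1)[OF Y] lim(1) \<xi>(1) _ \<open>e / 3 > 0\<close>] infY
      by (simp add: mgf_\<omega>[OF Y])
    moreover have "\<forall>\<^sub>F n in sequentially. concentration M2 (\<omega>2 (Y n)) < measure M2 {cnj \<xi>2} + e / 3"
      using snd.concentration_at_singularity[OF \<omega>_less(2)[OF Y] lim(2) \<xi>(2) _ \<open>e / 3 > 0\<close>] infY
      by (simp add: mgf_\<omega>[OF Y])
    moreover have "(\<lambda>n. (norm (Y n))\<^sup>2) \<longlonglongrightarrow> (norm \<zeta>)\<^sup>2"
      by (intro tendsto_intros lim)
    then have "\<forall>\<^sub>F n in sequentially. (norm (Y n))\<^sup>2 > 1 - e / 3"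
      using \<xi>(3) \<open>e / 3 > 0\<close> by (intro order_tendstoD(1)) auto
    ultimately show "\<forall>\<^sub>F n in sequentially. concentration M (Z (r n))
        < measure M1 {cnj \<xi>1} + measure M2 {cnj \<xi>2} - 1 + e"
    proof eventually_elim
      case (elim n)
      then show ?case using concentration_le[OF Y, of n] by (simp add: Y_def)
    qed
  qed
qed

text \<open>Concentrations are positive, so a singularity forces the two atoms to weigh at least 1 together.\<close>

lemma mgf_bounded_off_heavy:
  assumes "e > 0"
  shows "\<exists>C. \<forall>z. norm z < 1 \<longrightarrow> (\<forall>x\<in>heavy. e \<le> dist z x) \<longrightarrow> norm (mgf M z) \<le> C"
proof (rule ccontr)
  assume contra: "\<not> ?thesis"
  have "\<exists>z. norm z < 1 \<and> (\<forall>x\<in>heavy. e \<le> dist z x) \<and> real n < norm (mgf M z)" for n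
    using contra by (metis not_less)
  then obtain Z where Z: "\<And>n. norm (Z n) < 1" "\<And>n x. x \<in> heavy \<Longrightarrow> e \<le> dist (Z n) x"
    "\<And>n. real n < norm (mgf M (Z n))"
    by metis
  have "filterlim (\<lambda>n. norm (mgf M (Z n))) at_top sequentially"
    by (rule filterlim_at_top_mono[OF filterlim_real_sequentially])
       (use Z(3) in \<open>auto simp: less_imp_le\<close>)
  from singularity[of Z, OF Z(1) this] obtain r \<xi>1 \<xi>2 where *: "norm \<xi>1 = 1" "norm \<xi>2 = 1"
    "(Z \<circ> r) \<longlonglongrightarrow> \<xi>1 * \<xi>2"
    "\<And>e. e > 0 \<Longrightarrow> \<forall>\<^sub>F n in sequentially. concentration M (Z (r n))
        < measure M1 {cnj \<xi>1} + measure M2 {cnj \<xi>2} - 1 + e" by metis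
  have "0 \<le> measure M1 {cnj \<xi>1} + measure M2 {cnj \<xi>2} - 1 + e" if e: "e > 0" for e
  proof -
    obtain n where "concentration M (Z (r n)) < measure M1 {cnj \<xi>1} + measure M2 {cnj \<xi>2} - 1 + e"
      using eventually_happens'[OF sequentially_bot *(4)[OF e]] by blast
    then show ?thesis using concentration_pos[OF Z(1), of "r n"] by simp
  qed
  then have "0 \<le> measure M1 {cnj \<xi>1} + measure M2 {cnj \<xi>2} - 1"
    using field_le_epsilon[of 0 "measure M1 {cnj \<xi>1} + measure M2 {cnj \<xi>2} - 1"] by simp
  then have "\<xi>1 * \<xi>2 \<in> heavy"
    using *(1,2) unfolding heavy_def by (intro CollectI exI[of _ \<xi>1] exI[of _ \<xi>2]) simp
  moreover have "\<forall>\<^sub>F n in sequentially. dist ((Z \<circ> r) n) (\<xi>1 * \<xi>2) < e"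
    using *(3) assms by (rule tendstoD)
  then obtain n where "dist (Z (r n)) (\<xi>1 * \<xi>2) < e"
    using eventually_happens'[OF sequentially_bot] by fastforce
  ultimately show False using Z(2)[of "\<xi>1 * \<xi>2" "r n"] by simp
qed

text \<open>An atom of mass \<open>m\<close> makes the transform blow up radially while the concentration stays above
\<open>m\<^sup>2 / 2\<close>. In contrast, the estimate at a singularity leaves at most the excess over 1 of the two
atoms, which is not positive.\<close>

lemma no_atom:
  assumes "\<And>a b. a \<in> unit_circle \<Longrightarrow> b \<in> unit_circle \<Longrightarrow> measure M1 {a} + measure M2 {b} \<le> 1"
    and a: "a \<in> unit_circle"
  shows "measure M {a} = 0"
proof (rule ccontr)
  define m where "m = measure M {a}"
  assume "measure M {a} \<noteq> 0"
  then have m: "m > 0" by (simp add: m_def zero_less_measure_iff)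
  define r where "r = (\<lambda>n. 1 - 1 / real (Suc n))"
  define Z where "Z = (\<lambda>n. r n *\<^sub>R cnj a)"
  have r: "0 \<le> r n" "r n < 1" for n by (auto simp: r_def field_simps)
  have "(\<lambda>n. 1 / real (Suc n)) \<longlonglongrightarrow> 0"
    using LIMSEQ_inverse_real_of_nat by (simp add: inverse_eq_divide)
  from tendsto_diff[OF tendsto_const this, of 1] have "r \<longlonglongrightarrow> 1" by (simp add: r_def)
  from tendsto_norm[OF mgf_at_atom[OF r this, of "cnj a"]] a
  have lim: "(\<lambda>n. (1 - r n) * norm (mgf M (Z n))) \<longlonglongrightarrow> m"
    using r by (simp add: Z_def m_def abs_of_pos)
  have Z: "norm (Z n) = r n" "norm (Z n) < 1" for n using a r by (auto simp: Z_def)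
  have "filterlim (\<lambda>n. ((1 - r n) * norm (mgf M (Z n))) * real (Suc n)) at_top sequentially"
    by (rule filterlim_tendsto_pos_mult_at_top[OF lim m])
       (rule filterlim_compose[OF filterlim_real_sequentially filterlim_Suc])
  then have "filterlim (\<lambda>n. norm (mgf M (Z n))) at_top sequentially"
    by (simp add: r_def del: of_nat_Suc)
  from singularity[of Z, OF Z(2) this] obtain s \<xi>1 \<xi>2 where *: "strict_mono s" "norm \<xi>1 = 1" "norm \<xi>2 = 1"
    "\<And>e. e > 0 \<Longrightarrow> \<forall>\<^sub>F n in sequentially. concentration M (Z (s n))
        < measure M1 {cnj \<xi>1} + measure M2 {cnj \<xi>2} - 1 + e" by metis
  have conc: "((1 - r n) * norm (mgf M (Z n)))\<^sup>2 \<le> concentration M (Z n)" for n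
  proof -
    have "energy M (Z n) * (1 - r n)\<^sup>2 \<le> 1"
      using energy_le[OF Z(2)[of n]] Z(1)[of n] r(2)[of n] by (simp add: field_simps)
    then have "(norm (mgf M (Z n)))\<^sup>2 * (energy M (Z n) * (1 - r n)\<^sup>2) \<le> (norm (mgf M (Z n)))\<^sup>2"
      by (intro mult_left_le) auto
    then have "((1 - r n) * norm (mgf M (Z n)))\<^sup>2 * energy M (Z n) \<le> (norm (mgf M (Z n)))\<^sup>2"
      by (simp only: power_mult_distrib mult_ac)
    then show ?thesis
      using energy_ge[OF Z(2)[of n]] by (simp add: concentration_def pos_le_divide_eq)
  qed
  have "(\<lambda>n. ((1 - r n) * norm (mgf M (Z n)))\<^sup>2) \<longlonglongrightarrow> m\<^sup>2"
    by (intro tendsto_power lim)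
  then have "(\<lambda>n. ((1 - r (s n)) * norm (mgf M (Z (s n))))\<^sup>2) \<longlonglongrightarrow> m\<^sup>2"
    using LIMSEQ_subseq_LIMSEQ[OF _ *(1)] by (fastforce simp: o_def)
  then have "\<forall>\<^sub>F n in sequentially. m\<^sup>2 / 2 < ((1 - r (s n)) * norm (mgf M (Z (s n))))\<^sup>2"
    using m by (intro order_tendstoD(1)) auto
  moreover have "\<forall>\<^sub>F n in sequentially. concentration M (Z (s n))
      < measure M1 {cnj \<xi>1} + measure M2 {cnj \<xi>2} - 1 + m\<^sup>2 / 2"
    using *(4)[of "m\<^sup>2 / 2"] m by simp
  ultimately have "\<forall>\<^sub>F n in sequentially. False"
  proof eventually_elim
    case (elim n)
    then show False
      using conc[of "s n"] assms(1)[of "cnj \<xi>1" "cnj \<xi>2"] *(2,3) by simp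
  qed
  then show False by simp
qed

lemma heavy_circle: "heavy \<subseteq> unit_circle"
  by (auto simp: heavy_def norm_mult)

text \<open>As no atom of one law has mass 1, a heavy pair needs an atom of the other law whose mass is bounded
below, and there are finitely many of those.\<close>

lemma finite_heavy:
  assumes "\<not> point_mass M1" "\<not> point_mass M2"
  shows "finite heavy"
proof -
  obtain a where a: "a \<in> unit_circle" "\<And>b. b \<in> unit_circle \<Longrightarrow> measure M1 {b} \<le> measure M1 {a}"
    using fst.maximal_atom by blast
  obtain b where b: "b \<in> unit_circle" "\<And>c. c \<in> unit_circle \<Longrightarrow> measure M2 {c} \<le> measure M2 {b}"
    using snd.maximal_atom by blast
  define A where "A = {x \<in> unit_circle. 1 - measure M2 {b} \<le> measure M1 {x}}"
  define B where "B = {x \<in> unit_circle. 1 - measure M1 {a} \<le> measure M2 {x}}"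
  have "finite A"
    unfolding A_def using snd.atom_less_1[OF assms(2) b(1)] by (intro fst.finite_heavy_atoms) simp
  moreover have "finite B"
    unfolding B_def using fst.atom_less_1[OF assms(1) a(1)] by (intro snd.finite_heavy_atoms) simp
  ultimately have "finite ((\<lambda>(x, y). cnj x * cnj y) ` (A \<times> B))" by simp
  moreover have "heavy \<subseteq> (\<lambda>(x, y). cnj x * cnj y) ` (A \<times> B)"
  proof
    fix z assume "z \<in> heavy"
    then obtain x y where xy: "z = x * y" "x \<in> unit_circle" "y \<in> unit_circle"
      "1 \<le> measure M1 {cnj x} + measure M2 {cnj y}" by (auto simp: heavy_def)
    then have "cnj x \<in> A" "cnj y \<in> B"
      using a(2)[of "cnj x"] b(2)[of "cnj y"] by (auto simp: A_def B_def)
    then show "z \<in> (\<lambda>(x, y). cnj x * cnj y) ` (A \<times> B)"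
      using xy(1) by (intro image_eqI[of _ _ "(cnj x, cnj y)"]) auto
  qed
  ultimately show ?thesis by (rule finite_subset[rotated])
qed

lemma small_ball_measure_off_heavy:
  assumes "e > 0"
  obtains C where "C \<ge> 0" "\<And>t d. t \<in> unit_circle \<Longrightarrow> (\<forall>x\<in>heavy. e \<le> dist (cnj t) x) \<Longrightarrow>
    0 < d \<Longrightarrow> d < min 1 (e / 2) \<Longrightarrow> measure M (cball t d \<inter> unit_circle) \<le> C * d"
proof -
  obtain C where C: "\<And>z. norm z < 1 \<Longrightarrow> (\<forall>x\<in>heavy. e / 2 \<le> dist z x) \<Longrightarrow> norm (mgf M z) \<le> C"
    using mgf_bounded_off_heavy[of "e / 2"] assms by auto
  show thesis
  proof (rule that[of "8 * max C 0"])
    fix t d assume t: "t \<in> unit_circle" "\<forall>x\<in>heavy. e \<le> dist (cnj t) x" and d: "0 < d" "d < min 1 (e / 2)"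
    let ?z = "(1 - d) *\<^sub>R cnj t"
    have "cnj t - ?z = d *\<^sub>R cnj t" by (simp add: scaleR_diff_left)
    then have "dist (cnj t) ?z = d" using t(1) d by (simp add: dist_norm)
    then have "e / 2 \<le> dist ?z x" if "x \<in> heavy" for x
      using dist_triangle[of "cnj t" x ?z] t(2) that d by force
    moreover have "norm ?z < 1" using t(1) d by simp
    ultimately have "norm (mgf M ?z) \<le> max C 0" using C[of ?z] by force
    then have "8 * norm (mgf M ?z) * d \<le> 8 * max C 0 * d"
      using d by (intro mult_right_mono) auto
    then show "measure M (cball t d \<inter> unit_circle) \<le> 8 * max C 0 * d"
      using measure_cball_le_mgf[OF t(1) d(1)] d(2) by simp
  qed simp
qed

end

section \<open>Comparison with arclength\<close>

lemma norm_cis_diff_le: "norm (cis s - cis x) \<le> \<bar>s - x\<bar>"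
proof -
  have "cis s - cis x = cis x * (cis (s - x) - 1)"
    by (simp add: right_diff_distrib cis_mult)
  then have "norm (cis s - cis x) = norm (cis (s - x) - 1)"
    by (simp add: norm_mult)
  also have "\<dots> = 2 * \<bar>sin ((s - x) / 2)\<bar>"
    using dist_exp_i_1[of "s - x"] by (simp add: cis_conv_exp)
  also have "\<dots> \<le> \<bar>s - x\<bar>"
    using abs_sin_x_le_abs_x[of "(s - x) / 2"] by simp
  finally show ?thesis .
qed

lemma sets_arclength [simp]: "sets arclength = sets circle_borel"
  by (simp add: arclength_def)

lemma space_arclength [simp]: "space arclength = unit_circle"
  by (simp add: arclength_def)

lemma cis_measurable: "cis \<in> borel \<rightarrow>\<^sub>M circle_borel"
  by (intro measurable_restrict_space2 borel_measurable_continuous_onI continuous_on_cis) auto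

lemma emeasure_arclength:
  assumes "A \<in> sets circle_borel"
  shows "emeasure arclength A = emeasure lborel ({0..<2 * pi} \<inter> cis -` A)"
proof -
  have "cis \<in> restrict_space lborel {0..<2 * pi} \<rightarrow>\<^sub>M circle_borel"
    using cis_measurable by (intro measurable_restrict_space1) simp
  then show ?thesis
    using assms by (simp add: arclength_def emeasure_distr emeasure_restrict_space
        space_restrict_space Int_commute)
qed

lemma finite_measure_arclength: "finite_measure arclength"
proof
  have "emeasure arclength (space arclength) = emeasure lborel ({0..<2 * pi} \<inter> cis -` unit_circle)"
    using emeasure_arclength[of unit_circle] sets.top[of arclength] by simp
  also have "\<dots> \<le> emeasure lborel {0..2 * pi}"
    by (rule emeasure_mono) auto
  finally have "emeasure arclength (space arclength) \<le> emeasure lborel {0..2 * pi}" .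
  then show "emeasure arclength (space arclength) \<noteq> \<infinity>"
    by (auto simp: top_unique)
qed

lemma arclength_finite_set:
  assumes "finite F" "F \<subseteq> unit_circle"
  shows "F \<in> null_sets arclength"
proof -
  have "{x} \<in> null_sets arclength" if "x \<in> unit_circle" for x
  proof -
    have sets: "{x} \<in> sets circle_borel"
      using that by (auto simp: sets_restrict_space intro!: image_eqI[of _ _ "{x}"])
    have "s = Arg2pi x" if "s \<in> {0..<2 * pi} \<inter> cis -` {x}" for s
      using Arg2pi_unique[of 1 s x] that by (simp add: cis_conv_exp)
    then have "{0..<2 * pi} \<inter> cis -` {x} \<subseteq> {Arg2pi x}" by blast
    then have "emeasure lborel ({0..<2 * pi} \<inter> cis -` {x}) \<le> emeasure lborel {Arg2pi x}"
      by (intro emeasure_mono) auto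
    then show ?thesis using sets by (auto simp: null_sets_def emeasure_arclength)
  qed
  then have "(\<Union>x\<in>F. {x}) \<in> null_sets arclength"
    using assms by (intro null_sets_UN') (auto intro: countable_finite)
  then show ?thesis by simp
qed

text \<open>The preimage of \<open>A\<close> in \<open>[0, 2 pi)\<close> has an open neighbourhood of almost the same length. The covering
lemma covers the preimage by nonoverlapping short intervals that lie in the neighbourhood and meet
the preimage. Every one of these is mapped by \<open>cis\<close> into the ball around a point of \<open>A\<close> whose radius is the length of the interval.\<close>

lemma (in circle_law) emeasure_le_arclength:
  assumes A: "A \<in> sets M" and "C \<ge> 0" "d0 > 0"
    and ball: "\<And>t d. t \<in> A \<Longrightarrow> 0 < d \<Longrightarrow> d < d0 \<Longrightarrow> measure M (cball t d \<inter> unit_circle) \<le> C * d"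
  shows "emeasure M A \<le> ennreal C * emeasure arclength A"
proof (rule ennreal_le_epsilon)
  define B where "B = {0..<2 * pi} \<inter> cis -` A"
  have A_circle: "A \<subseteq> unit_circle" using sets.sets_into_space[OF A] by (simp add: space_M)
  have B: "B \<in> sets borel"
    using measurable_sets[OF cis_measurable, of A] A unfolding B_def sets_M by auto
  have B_len: "emeasure lborel B = emeasure arclength A"
    using A by (simp add: B_def emeasure_arclength sets_M)
  fix \<epsilon> :: real assume "\<epsilon> > 0"
  define e where "e = \<epsilon> / (C + 1)"
  have e: "e > 0" "C * e \<le> \<epsilon>" using \<open>\<epsilon> > 0\<close> \<open>C \<ge> 0\<close> by (auto simp: e_def field_simps)
  obtain U where U: "open U" "B \<subseteq> U" "emeasure lborel (U - B) < e"
    using outer_regular_lborel[OF B e(1)] by blast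
  define g where "g = (\<lambda>x. if x \<in> U then U \<inter> ball x (d0 / 2) else ball x 1)"
  have "gauge g" using U(1) \<open>d0 > 0\<close> by (auto simp: gauge_def g_def)
  have cover: "B \<subseteq> cbox 0 (2 * pi)" "box 0 (2 * pi) \<noteq> {}"
    using pi_gt_zero by (auto simp: B_def simp del: pi_gt_zero)
  have "\<exists>\<D>. countable \<D> \<and> (\<forall>K\<in>\<D>. interior K \<noteq> {} \<and> (\<exists>c d. K = cbox c d)) \<and>
      pairwise (\<lambda>A B. interior A \<inter> interior B = {}) \<D> \<and>
      (\<forall>K\<in>\<D>. \<exists>x\<in>B \<inter> K. K \<subseteq> g x) \<and> B \<subseteq> \<Union>\<D>"
  proof (rule covering_lemma[OF cover \<open>gauge g\<close>])
    fix \<D>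
    assume "countable \<D>" and boxes: "\<And>K. K \<in> \<D> \<Longrightarrow> interior K \<noteq> {} \<and> (\<exists>c d. K = cbox c d)"
      and "pairwise (\<lambda>A B. interior A \<inter> interior B = {}) \<D>"
      and fine: "\<And>K. K \<in> \<D> \<Longrightarrow> \<exists>x\<in>B \<inter> K. K \<subseteq> g x" and "B \<subseteq> \<Union>\<D>"
    moreover from boxes have "\<forall>K\<in>\<D>. interior K \<noteq> {} \<and> (\<exists>c d. K = cbox c d)" by (rule ballI)
    moreover from fine have "\<forall>K\<in>\<D>. \<exists>x\<in>B \<inter> K. K \<subseteq> g x" by (rule ballI)
    ultimately show ?thesis by (intro exI[of _ \<D>] conjI)
  qed
  then obtain \<D> where \<D>: "countable \<D>"
    "\<forall>K\<in>\<D>. interior K \<noteq> {} \<and> (\<exists>c d. K = cbox c d)"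
    "pairwise (\<lambda>A B. interior A \<inter> interior B = {}) \<D>"
    "\<forall>K\<in>\<D>. \<exists>x\<in>B \<inter> K. K \<subseteq> g x" "B \<subseteq> \<Union>\<D>"
    by (elim exE conjE)
  \<comment> \<open>The family may be finite, so its enumeration is padded with empty sets.\<close>
  define F where "F = (\<lambda>n. if n \<in> to_nat_on \<D> ` \<D> then from_nat_into \<D> n else {})"
  have F: "F n \<in> \<D> \<or> F n = {}" for n
    using \<D>(1) by (auto simp: F_def)
  have F_cover: "\<exists>n. F n = K" if "K \<in> \<D>" for K
    using that \<D>(1) by (intro exI[of _ "to_nat_on \<D> K"]) (simp add: F_def)
  have F_disj: "disjoint_family (\<lambda>n. interior (F n))"
  proof (unfold disjoint_family_on_def, intro ballI impI)
    fix m n :: nat assume "m \<noteq> n"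
    then have "F m = {} \<or> F n = {} \<or> (F m \<in> \<D> \<and> F n \<in> \<D> \<and> F m \<noteq> F n)"
      using \<D>(1) by (auto simp: F_def)
    then show "interior (F m) \<inter> interior (F n) = {}"
      using \<D>(3) by (auto simp: pairwise_def)
  qed
  have "\<exists>T\<in>sets M. cis ` F n \<subseteq> T \<and> emeasure M T \<le> ennreal C * emeasure lborel (interior (F n)) \<and> F n \<subseteq> U" for n
  proof (cases "F n = {}")
    case True
    then show ?thesis by (intro bexI[of _ "{}"]) auto
  next
    case False
    then have K: "F n \<in> \<D>" using F by blast
    obtain c d where cd: "F n = {c..d}" using bspec[OF \<D>(2) K] by auto
    have "c < d" using bspec[OF \<D>(2) K] by (simp add: cd)
    obtain x where x: "x \<in> B" "x \<in> F n" "F n \<subseteq> g x" using bspec[OF \<D>(4) K] by blast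
    then have sub: "F n \<subseteq> U" "F n \<subseteq> ball x (d0 / 2)" 
      using subsetD[OF U(2) x(1)] by (auto simp: g_def)
    have "c \<in> F n" "d \<in> F n" using \<open>c < d\<close> by (auto simp: cd)
    then have "dist x c < d0 / 2" "dist x d < d0 / 2" using sub(2) by auto
    then have "d - c < d0" unfolding dist_real_def by arith
    define T where "T = cball (cis x) (d - c) \<inter> unit_circle"
    have "T \<in> sets M" using circle_Borel_sets by (simp add: T_def)
    moreover have "cis ` F n \<subseteq> T"
    proof
      fix z assume "z \<in> cis ` F n"
      then obtain s where s: "z = cis s" "s \<in> {c..d}" by (auto simp: cd)
      have "dist (cis x) (cis s) \<le> d - c"
        using norm_cis_diff_le[of x s] s(2) x(2) by (auto simp: cd dist_norm)
      then show "z \<in> T" by (simp add: T_def s)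
    qed
    moreover have "emeasure M T \<le> ennreal (C * (d - c))"
      using ball[of "cis x" "d - c"] x(1) \<open>c < d\<close> \<open>d - c < d0\<close>
      by (auto simp: emeasure_eq_measure T_def B_def intro!: ennreal_leI)
    then have "emeasure M T \<le> ennreal C * emeasure lborel (interior (F n))"
      using \<open>c < d\<close> \<open>C \<ge> 0\<close> by (simp add: cd interior_atLeastAtMost_real ennreal_mult)
    ultimately show ?thesis using sub(1) by blast
  qed
  then obtain T where T: "\<And>n. T n \<in> sets M" "\<And>n. cis ` F n \<subseteq> T n"
    "\<And>n. emeasure M (T n) \<le> ennreal C * emeasure lborel (interior (F n))" "\<And>n. F n \<subseteq> U"
    by metis
  have "A \<subseteq> (\<Union>n. T n)"
  proof
    fix t assume t: "t \<in> A"
    then have "norm t = 1" using A_circle by auto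
    then obtain \<theta> where \<theta>: "0 \<le> \<theta>" "\<theta> < 2 * pi" "t = cis \<theta>"
      using complex_unimodular_polar[of t] by (metis cis.code complex_eq_iff cis.sel)
    then have "\<theta> \<in> B" using t by (simp add: B_def)
    then obtain K where "K \<in> \<D>" "\<theta> \<in> K" using \<D>(5) by blast
    then obtain n where "\<theta> \<in> F n" using F_cover by metis
    then show "t \<in> (\<Union>n. T n)" using T(2)[of n] \<theta>(3) by blast
  qed
  then have "emeasure M A \<le> emeasure M (\<Union>n. T n)"
    using T(1) by (intro emeasure_mono) auto
  also have "\<dots> \<le> (\<Sum>n. emeasure M (T n))"
    using T(1) by (intro emeasure_subadditive_countably) auto
  also have "\<dots> \<le> (\<Sum>n. ennreal C * emeasure lborel (interior (F n)))"
    by (intro suminf_le T(3)) auto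
  also have "\<dots> = ennreal C * emeasure lborel (\<Union>n. interior (F n))"
    by (subst suminf_emeasure[symmetric]) (auto simp: F_disj)
  also have "\<dots> \<le> ennreal C * emeasure lborel U"
  proof (intro mult_left_mono emeasure_mono)
    show "(\<Union>n. interior (F n)) \<subseteq> U" using T(4) interior_subset by blast
  qed (use U(1) in auto)
  also have "emeasure lborel U = emeasure lborel B + emeasure lborel (U - B)"
    using plus_emeasure[of B lborel "U - B"] B U by (simp add: Un_absorb1)
  also have "ennreal C * \<dots> \<le> ennreal C * (emeasure lborel B + ennreal e)"
    using U(3) by (intro mult_left_mono add_left_mono) auto
  also have "\<dots> = ennreal C * emeasure lborel B + ennreal (C * e)"
    using \<open>C \<ge> 0\<close> e(1) by (simp add: distrib_left ennreal_mult)
  also have "\<dots> \<le> ennreal C * emeasure lborel B + ennreal \<epsilon>"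
    using e(2) by (intro add_left_mono ennreal_leI)
  finally show "emeasure M A \<le> ennreal C * emeasure arclength A + ennreal \<epsilon>"
    by (simp add: B_len)
qed

text \<open>The set where the density is at least \<open>C + 1\<close> has measure 0, since otherwise its mass would exceed
the assumed bound. There the density may be cut off.\<close>

lemma bounded_density:
  assumes "finite_measure N" "sets M = sets N" "C \<ge> 0"
    and le: "\<And>A. A \<in> sets N \<Longrightarrow> emeasure M A \<le> ennreal C * emeasure N A"
  shows "\<exists>f\<in>borel_measurable N. M = density N f \<and> (\<forall>x. f x \<le> ennreal (C + 1))"
proof -
  interpret N: finite_measure N by fact
  define g where "g = RN_deriv N M"
  define f where "f = (\<lambda>x. min (g x) (ennreal (C + 1)))"
  have g[measurable]: "g \<in> borel_measurable N" by (simp add: g_def)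
  have "absolutely_continuous N M"
    using le assms(2) by (force simp: absolutely_continuous_def null_sets_def)
  then have M: "density N g = M"
    unfolding g_def using assms(2) by (rule N.density_RN_deriv)
  define S where "S = {x \<in> space N. ennreal (C + 1) \<le> g x}"
  have S[measurable]: "S \<in> sets N" by (simp add: S_def)
  have "ennreal (C + 1) * emeasure N S = (\<integral>\<^sup>+x. ennreal (C + 1) * indicator S x \<partial>N)"
    by (simp add: nn_integral_cmult_indicator)
  also have "\<dots> \<le> (\<integral>\<^sup>+x. g x * indicator S x \<partial>N)"
    by (intro nn_integral_mono) (auto simp: S_def split: split_indicator)
  also have "\<dots> = emeasure M S"
    by (subst M[symmetric]) (simp add: emeasure_density)
  also have "\<dots> \<le> ennreal C * emeasure N S" by (rule le) (rule S)
  finally have "ennreal ((C + 1) * measure N S) \<le> ennreal (C * measure N S)"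
    using \<open>C \<ge> 0\<close> by (simp add: N.emeasure_eq_measure ennreal_mult)
  then have "(C + 1) * measure N S \<le> C * measure N S"
    using \<open>C \<ge> 0\<close> by (simp add: ennreal_le_iff)
  then have "measure N S = 0" using measure_nonneg[of N S] by (simp add: distrib_right)
  then have "S \<in> null_sets N" by (simp add: null_sets_def N.emeasure_eq_measure)
  then have "AE x in N. x \<notin> S" by (rule AE_not_in)
  then have "AE x in N. g x = f x"
    by (rule AE_mp) (auto simp: S_def f_def min_def)
  then have "density N g = density N f"
    by (intro density_cong) (auto simp: f_def)
  then show ?thesis
    using M by (intro bexI[of _ f] conjI allI) (simp_all add: f_def)
qed

section \<open>Lebesgue decomposition\<close>

text \<open>Two decompositions share a null set that carries both singular parts, and on a null set the singular
part coincides with the measure.\<close>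

lemma lebesgue_decomposition_singular_part:
  assumes "lebesgue_decomposition N M Ma Ms"
  shows "singular_part N M = Ms"
  unfolding singular_part_def
proof (rule the_equality)
  show "\<exists>Ma. lebesgue_decomposition N M Ma Ms" using assms by blast
  fix Ms' assume "\<exists>Ma. lebesgue_decomposition N M Ma Ms'"
  then obtain Ma' where dec': "lebesgue_decomposition N M Ma' Ms'" by blast
  have "mutually_singular N Ms" "mutually_singular N Ms'"
    using assms dec' by (simp_all only: lebesgue_decomposition_def)
  then obtain S S' where S: "S \<in> sets N" "emeasure N S = 0" "emeasure Ms (space N - S) = 0" "sets Ms = sets N"
    and S': "S' \<in> sets N" "emeasure N S' = 0" "emeasure Ms' (space N - S') = 0" "sets Ms' = sets N"
    unfolding mutually_singular_def by metis
  define T where "T = S \<union> S'"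
  have T: "T \<in> null_sets N" unfolding T_def using S(1,2) S'(1,2) by (intro null_sets.Un) (auto simp: null_sets_def)
  have on_T: "emeasure Ns A = emeasure M (A \<inter> T)"
    if dec: "lebesgue_decomposition N M Na Ns" and R: "R \<subseteq> T" "R \<in> sets N" "emeasure Ns (space N - R) = 0"
      and A: "A \<in> sets N" for Na Ns R A
  proof -
    have sets: "sets Na = sets N" "sets Ns = sets N" "sets M = sets N"
      using dec by (auto simp: lebesgue_decomposition_def mutually_singular_def)
    have T_sets: "T \<in> sets N" using T by auto
    have "A \<inter> T \<in> null_sets N"
      using null_set_Int1[OF T A] by (simp add: Int_commute)
    then have "emeasure Na (A \<inter> T) = 0"
      using dec by (auto simp: lebesgue_decomposition_def absolutely_continuous_def)
    moreover have "emeasure M (A \<inter> T) = emeasure Na (A \<inter> T) + emeasure Ns (A \<inter> T)"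
      using dec A T_sets sets by (auto simp: lebesgue_decomposition_def)
    moreover have "emeasure Ns A = emeasure Ns (A \<inter> T)"
    proof (rule emeasure_eq_AE)
      have "space N - R \<in> null_sets Ns" using R sets by (auto simp: null_sets_def)
      then have "AE x in Ns. x \<notin> space N - R" by (rule AE_not_in)
      then show "AE x in Ns. x \<in> A \<longleftrightarrow> x \<in> A \<inter> T"
        using R(1) sets.sets_into_space[OF A] by (auto elim!: eventually_mono)
    qed (use A T_sets sets in auto)
    ultimately show ?thesis by simp
  qed
  show "Ms' = Ms"
  proof (rule measure_eqI)
    fix A assume "A \<in> sets Ms'"
    then have "A \<in> sets N" using S' by simp
    then show "emeasure Ms' A = emeasure Ms A"
      using on_T[OF dec' _ S'(1,3)] on_T[OF assms _ S(1,3)] by (simp add: T_def)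
  qed (use S S' in simp)
qed

text \<open>A finite set that carries the singular part leaves nothing without atoms: each of its points is either
an atom or has mass 0.\<close>

lemma (in circle_law) atomic_singular_part:
  assumes E: "finite E" "E \<subseteq> unit_circle"
    and ac: "\<And>A. A \<in> null_sets arclength \<Longrightarrow> A \<inter> E = {} \<Longrightarrow> emeasure M A = 0"
  shows "singular_continuous_part arclength M = null_measure arclength"
proof -
  define Ma where "Ma = density M (indicator (unit_circle - E))"
  define Ms where "Ms = density M (indicator E)"
  have fin: "F \<in> sets M" if "F \<subseteq> E" for F
  proof -
    have "F = \<Union>((\<lambda>x. {x}) ` F)" by auto
    also have "\<dots> \<in> sets M"
      using that E finite_subset[OF that] singleton_sets by (intro sets.finite_UN) auto
    finally show ?thesis .
  qed
  have circle: "unit_circle \<in> sets M" using sets.top[of M] by (simp add: space_M)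
  have Ma: "emeasure Ma A = emeasure M (A - E)" if "A \<in> sets M" for A
  proof -
    have "emeasure Ma A = (\<integral>\<^sup>+x. indicator (unit_circle - E) x * indicator A x \<partial>M)"
      unfolding Ma_def using that circle fin[OF order_refl] by (intro emeasure_density) auto
    also have "\<dots> = (\<integral>\<^sup>+x. indicator (A - E) x \<partial>M)"
      by (rule nn_integral_cong) (auto simp: space_M split: split_indicator)
    finally show ?thesis using that fin[OF order_refl] by simp
  qed
  have Ms: "emeasure Ms A = emeasure M (A \<inter> E)" if "A \<in> sets M" for A
  proof -
    have "emeasure Ms A = (\<integral>\<^sup>+x. indicator E x * indicator A x \<partial>M)"
      unfolding Ms_def using that fin[OF order_refl] by (intro emeasure_density) auto
    also have "\<dots> = (\<integral>\<^sup>+x. indicator (A \<inter> E) x \<partial>M)"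
      by (rule nn_integral_cong) (auto split: split_indicator)
    finally show ?thesis using that fin[OF order_refl] by simp
  qed
  have sets: "sets Ma = sets M" "sets Ms = sets M" by (simp_all add: Ma_def Ms_def)
  have E_sets: "E \<in> sets M" by (rule fin) simp
  have "lebesgue_decomposition arclength M Ma Ms"
    unfolding lebesgue_decomposition_def
  proof (intro conjI ballI sets)
    fix A assume A: "A \<in> sets M"
    have "(A - E) \<union> (A \<inter> E) = A" "(A - E) \<inter> (A \<inter> E) = {}" by auto
    then show "emeasure M A = emeasure Ma A + emeasure Ms A"
      using plus_emeasure[of "A - E" M "A \<inter> E"] A E_sets by (auto simp: Ma Ms)
  next
    show "absolutely_continuous arclength Ma"
      unfolding absolutely_continuous_def
    proof
      fix A assume A: "A \<in> null_sets arclength"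
      then have AM: "A \<in> sets M" by (auto simp: sets_M)
      have "A - E \<in> null_sets arclength"
        using null_set_Diff[OF A, of E] E_sets by (simp add: sets_M)
      then have "emeasure M (A - E) = 0" by (rule ac) auto
      then show "A \<in> null_sets Ma" using AM by (simp add: null_sets_def sets Ma)
    qed
    have "emeasure Ms (space arclength - E) = emeasure M ((space arclength - E) \<inter> E)"
      using circle E_sets by (intro Ms) auto
    also have "(space arclength - E) \<inter> E = {}" by auto
    finally have "emeasure Ms (space arclength - E) = 0" by simp
    then show "mutually_singular arclength Ms"
      unfolding mutually_singular_def using E_sets arclength_finite_set[OF E]
      by (intro conjI bexI[of _ E]) (auto simp: sets sets_M)
  qed
  then have sing: "singular_part arclength M = Ms" by (rule lebesgue_decomposition_singular_part)
  define Z where "Z = {x \<in> space Ms. emeasure Ms {x} = 0}"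
  have space: "space Ms = unit_circle" by (simp add: Ms_def space_M)
  have "Z = unit_circle - {x \<in> E. emeasure Ms {x} \<noteq> 0}"
    unfolding Z_def space using singleton_sets by (auto simp: Ms)
  then have Z: "Z \<in> sets Ms"
    using circle fin[of "{x \<in> E. emeasure Ms {x} \<noteq> 0}"] by (auto simp: sets)
  show ?thesis
    unfolding singular_continuous_part_def sing atomless_part_def Z_def[symmetric]
  proof (rule measure_eqI)
    show "sets (density Ms (indicator Z)) = sets (null_measure arclength)"
      by (simp add: sets sets_M)
    fix A assume "A \<in> sets (density Ms (indicator Z))"
    then have A: "A \<in> sets M" by (simp add: sets)
    have "emeasure (density Ms (indicator Z)) A = (\<integral>\<^sup>+x. indicator Z x * indicator A x \<partial>Ms)"
      using A Z by (intro emeasure_density borel_measurable_indicator) (auto simp: sets)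
    also have "\<dots> = (\<integral>\<^sup>+x. indicator (A \<inter> Z) x \<partial>Ms)"
      by (rule nn_integral_cong) (auto split: split_indicator)
    also have "\<dots> = emeasure Ms (A \<inter> Z)" using A Z by (simp add: sets)
    also have "\<dots> = emeasure M (A \<inter> Z \<inter> E)" using A Z by (intro Ms) (auto simp: sets)
    also have "\<dots> = (\<Sum>x\<in>A \<inter> Z \<inter> E. emeasure M {x})"
      using E singleton_sets by (intro emeasure_eq_sum_singleton) auto
    also have "\<dots> = 0"
    proof (rule sum.neutral, rule ballI)
      fix x assume x: "x \<in> A \<inter> Z \<inter> E"
      then have "emeasure Ms {x} = 0" by (simp add: Z_def)
      moreover have "{x} \<inter> E = {x}" using x by auto
      ultimately show "emeasure M {x} = 0" using Ms[OF singleton_sets, of x] x E by auto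
    qed
    finally show "emeasure (density Ms (indicator Z)) A = emeasure (null_measure arclength) A" by simp
  qed
qed

section \<open>Regularity of the convolution\<close>

lemma max_atom_sum_ge:
  assumes "circle_law M1" "circle_law M2" "x \<in> unit_circle" "y \<in> unit_circle"
  shows "measure M1 {x} + measure M2 {y} \<le> max_atom_sum M1 M2"
proof -
  interpret fst: circle_law M1 by fact
  interpret snd: circle_law M2 by fact
  obtain a where a: "a \<in> unit_circle" "\<And>b. b \<in> unit_circle \<Longrightarrow> measure M1 {b} \<le> measure M1 {a}"
    using fst.maximal_atom by blast
  obtain b where b: "b \<in> unit_circle" "\<And>c. c \<in> unit_circle \<Longrightarrow> measure M2 {c} \<le> measure M2 {b}"
    using snd.maximal_atom by blast
  have "max_atom_sum M1 M2 = measure M1 {a} + measure M2 {b}"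
    unfolding max_atom_sum_def
  proof (rule Greatest_equality)
    show "\<exists>\<alpha>\<^sub>1\<in>unit_circle. \<exists>\<alpha>\<^sub>2\<in>unit_circle.
        measure M1 {a} + measure M2 {b} = measure M1 {\<alpha>\<^sub>1} + measure M2 {\<alpha>\<^sub>2}"
      using a(1) b(1) by blast
  qed (use a b in \<open>auto intro: add_mono\<close>)
  then show ?thesis using a(2)[OF assms(3)] b(2)[OF assms(4)] by simp
qed

context subordinate_laws
begin

text \<open>Bounded transform means bounded Poisson integral, hence balls of measure at most proportional to their
radius. The conjugation appears because the transform at \<open>z\<close> sees the law near \<open>cnj z\<close>.\<close>

lemma emeasure_le_off_heavy:
  assumes "e > 0"
  shows "\<exists>C\<ge>0. \<forall>A\<in>sets M. A \<subseteq> {t. \<forall>x\<in>heavy. e \<le> dist (cnj t) x} \<longrightarrow>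
    emeasure M A \<le> ennreal C * emeasure arclength A"
proof -
  obtain C where C: "C \<ge> 0" "\<And>t d. t \<in> unit_circle \<Longrightarrow> (\<forall>x\<in>heavy. e \<le> dist (cnj t) x) \<Longrightarrow>
    0 < d \<Longrightarrow> d < min 1 (e / 2) \<Longrightarrow> measure M (cball t d \<inter> unit_circle) \<le> C * d"
    using small_ball_measure_off_heavy[OF assms] by blast
  show ?thesis
  proof (intro exI[of _ C] conjI C(1) ballI impI)
    fix A assume A: "A \<in> sets M" "A \<subseteq> {t. \<forall>x\<in>heavy. e \<le> dist (cnj t) x}"
    show "emeasure M A \<le> ennreal C * emeasure arclength A"
    proof (rule emeasure_le_arclength[OF A(1) C(1), of "min 1 (e / 2)"])
      show "measure M (cball t d \<inter> unit_circle) \<le> C * d" if "t \<in> A" "0 < d" "d < min 1 (e / 2)" for t d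
        using that A(2) sets.sets_into_space[OF A(1)] by (intro C(2)) (auto simp: space_M)
    qed (use assms in simp)
  qed
qed

text \<open>The complement of the exceptional set is exhausted by sets of positive distance from it, on each of
which the law is dominated by a multiple of arclength.\<close>

lemma absolutely_continuous_off_heavy:
  assumes "finite heavy" "A \<in> null_sets arclength" "A \<inter> cnj ` heavy = {}"
  shows "emeasure M A = 0"
proof -
  define S where "S = (\<lambda>n. {t. \<forall>x\<in>heavy. 1 / real (Suc n) \<le> dist (cnj t) x})"
  have "A \<in> sets arclength" using assms(2) by auto
  then have A: "A \<in> sets M" "A \<subseteq> unit_circle"
    using sets.sets_into_space[of A arclength] by (simp_all add: sets_M)
  have S: "A \<inter> S n \<in> null_sets M" for n
  proof -
    have "S n = (\<Inter>x\<in>heavy. {t. 1 / real (Suc n) \<le> dist (cnj t) x})" by (auto simp: S_def)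
    moreover have "closed {t. 1 / real (Suc n) \<le> dist (cnj t) x}" for x
      by (intro closed_Collect_le continuous_intros)
    ultimately have "closed (S n)" by auto
    then have "S n \<inter> unit_circle \<in> sets M" by (intro circle_Borel_sets borel_closed)
    then have "A \<inter> (S n \<inter> unit_circle) \<in> sets M" using A(1) by auto
    also have "A \<inter> (S n \<inter> unit_circle) = A \<inter> S n" using A(2) by auto
    finally have sets: "A \<inter> S n \<in> sets M" .
    obtain C where "emeasure M (A \<inter> S n) \<le> ennreal C * emeasure arclength (A \<inter> S n)"
      using emeasure_le_off_heavy[of "1 / real (Suc n)"] sets unfolding S_def
      by (metis (no_types, lifting) Int_lower2 of_nat_0_less_iff zero_less_Suc zero_less_divide_1_iff)
    moreover have "emeasure arclength (A \<inter> S n) \<le> emeasure arclength A"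
      using assms(2) by (intro emeasure_mono) auto
    ultimately have "emeasure M (A \<inter> S n) = 0"
      using assms(2) by (auto simp: null_sets_def)
    then show ?thesis using sets by (simp add: null_sets_def)
  qed
  have "A \<subseteq> (\<Union>n. A \<inter> S n)"
  proof
    fix t assume t: "t \<in> A"
    obtain d where d: "d > 0" "\<forall>x\<in>heavy. x \<noteq> cnj t \<longrightarrow> d \<le> dist (cnj t) x"
      using finite_set_avoid[OF assms(1)] by blast
    obtain n where n: "inverse (real (Suc n)) < d" using reals_Archimedean[OF d(1)] by blast
    have "cnj t \<notin> heavy"
      using t assms(3) by (metis IntI complex_cnj_cnj emptyE imageI)
    then have "t \<in> S n" using d(2) n by (force simp: S_def inverse_eq_divide)
    then show "t \<in> (\<Union>n. A \<inter> S n)" using t by blast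
  qed
  then have "A = (\<Union>n. A \<inter> S n)" by blast
  moreover have "(\<Union>n. A \<inter> S n) \<in> null_sets M" using S by (rule null_sets_UN)
  ultimately show ?thesis by (metis null_setsD1)
qed

end

theorem theorem3p2:
  fixes \<mu>\<^sub>1 \<mu>\<^sub>2 \<mu> :: "complex measure"
  assumes "circle_prob \<mu>\<^sub>1" and "circle_prob \<mu>\<^sub>2"
    and "\<not> point_mass \<mu>\<^sub>1" and "\<not> point_mass \<mu>\<^sub>2"
    and conv: "is_free_mult_convolution TYPE('a::cstar_algebra) \<mu>\<^sub>1 \<mu>\<^sub>2 \<mu>"
  shows "singular_continuous_part arclength \<mu> = null_measure arclength \<and>
    (max_atom_sum \<mu>\<^sub>1 \<mu>\<^sub>2 \<le> 1 \<longrightarrow> absolutely_continuous arclength \<mu>) \<and>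
    (max_atom_sum \<mu>\<^sub>1 \<mu>\<^sub>2 < 1 \<longrightarrow>
       (\<exists>f\<in>borel_measurable arclength. \<mu> = density arclength f \<and>
          (\<exists>C::real. \<forall>t\<in>unit_circle. f t \<le> ennreal C)))"
proof -
  obtain \<tau> :: "'a \<Rightarrow> complex" and u v where \<tau>: "faithful_tracial_state \<tau>"
    and u: "unitary u" "unitary v" and free: "star_free \<tau> u v"
    and distr: "has_distribution \<tau> u \<mu>\<^sub>1" "has_distribution \<tau> v \<mu>\<^sub>2" "has_distribution \<tau> (u * v) \<mu>"
    using conv unfolding is_free_mult_convolution_def by blast
  have law: "unitary_law \<tau> w N" if "unitary w" "has_distribution \<tau> w N" for w N
    using that \<tau> unfolding unitary_law_def unitary_law_axioms_def cstar_trace_def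
    by (auto simp: has_distribution_def circle_law_iff)
  have "adj (u * v) * (u * v) = adj v * (adj u * u) * v" "(u * v) * adj (u * v) = u * (v * adj v) * adj u"
    by (simp_all add: adj_mult mult.assoc)
  then have uv: "unitary (u * v)" using u by (simp add: unitary_def)
  obtain \<omega>1 \<omega>2 where \<omega>: "\<And>z. norm z < 1 \<Longrightarrow> norm (\<omega>1 z) < 1" "\<And>z. norm z < 1 \<Longrightarrow> norm (\<omega>2 z) < 1"
    "\<And>z. norm z < 1 \<Longrightarrow> mgf \<mu>\<^sub>1 (\<omega>1 z) = mgf \<mu> z" "\<And>z. norm z < 1 \<Longrightarrow> mgf \<mu>\<^sub>2 (\<omega>2 z) = mgf \<mu> z"
    "\<And>z. norm z < 1 \<Longrightarrow> \<omega>1 z * \<omega>2 z = z * (1 - 1 / mgf \<mu> z)"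
    by (rule subordination[OF law[OF u(1) distr(1)] law[OF u(2) distr(2)] law[OF uv distr(3)] free]) blast
  have "circle_law \<mu>\<^sub>1" "circle_law \<mu>\<^sub>2" "circle_law \<mu>"
    using distr by (simp_all add: has_distribution_def circle_law_iff)
  then interpret subordinate_laws \<mu>\<^sub>1 \<mu>\<^sub>2 \<mu> \<omega>1 \<omega>2
    by (intro subordinate_laws.intro subordinate_laws_axioms.intro \<omega>)
  note atoms = max_atom_sum_ge[OF fst.circle_law_axioms snd.circle_law_axioms]
  have fin: "finite heavy" by (rule finite_heavy[OF assms(3,4)])
  have conj: "cnj ` heavy \<subseteq> unit_circle" using heavy_circle by auto
  have "singular_continuous_part arclength \<mu> = null_measure arclength"
    using fin conj absolutely_continuous_off_heavy[OF fin] by (intro atomic_singular_part[of "cnj ` heavy"]) auto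
  moreover have "absolutely_continuous arclength \<mu>" if "max_atom_sum \<mu>\<^sub>1 \<mu>\<^sub>2 \<le> 1"
    unfolding absolutely_continuous_def
  proof
    fix A assume A: "A \<in> null_sets arclength"
    let ?E = "cnj ` heavy"
    have "{x} \<in> null_sets \<mu>" if "x \<in> ?E" for x
      using no_atom[of x] order_trans[OF atoms \<open>max_atom_sum \<mu>\<^sub>1 \<mu>\<^sub>2 \<le> 1\<close>] that conj singleton_sets[of x]
      by (auto simp: null_sets_def emeasure_eq_measure)
    then have "(\<Union>x\<in>?E. {x}) \<in> null_sets \<mu>"
      using fin by (intro null_sets_UN') (auto intro: countable_finite)
    then have E: "?E \<in> null_sets \<mu>" by simp
    have E_sets: "?E \<in> sets arclength" using E by (auto simp: sets_M)
    have "A - ?E \<in> null_sets arclength" by (rule null_set_Diff[OF A E_sets])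
    then have "emeasure \<mu> (A - ?E) = 0" by (rule absolutely_continuous_off_heavy[OF fin]) auto
    moreover have "A - ?E \<in> sets \<mu>" using A E_sets by (auto simp: sets_M)
    ultimately have "(A - ?E) \<union> ?E \<in> null_sets \<mu>"
      using E by (intro null_sets.Un) (auto simp: null_sets_def)
    then show "A \<in> null_sets \<mu>"
      by (rule null_sets_subset) (use A in \<open>auto simp: sets_M\<close>)
  qed
  moreover have "\<exists>f\<in>borel_measurable arclength. \<mu> = density arclength f \<and>
      (\<exists>C::real. \<forall>t\<in>unit_circle. f t \<le> ennreal C)" if "max_atom_sum \<mu>\<^sub>1 \<mu>\<^sub>2 < 1"
  proof -
    have "\<not> 1 \<le> measure \<mu>\<^sub>1 {cnj x} + measure \<mu>\<^sub>2 {cnj y}"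
      if "x \<in> unit_circle" "y \<in> unit_circle" for x y
      using atoms[of "cnj x" "cnj y"] that \<open>max_atom_sum \<mu>\<^sub>1 \<mu>\<^sub>2 < 1\<close> by simp
    then have "heavy = {}" unfolding heavy_def by blast
    have "\<exists>C\<ge>0. \<forall>A\<in>sets \<mu>. emeasure \<mu> A \<le> ennreal C * emeasure arclength A"
      using emeasure_le_off_heavy[of 1] unfolding \<open>heavy = {}\<close> by simp
    then obtain C where C: "C \<ge> 0" "\<And>A. A \<in> sets \<mu> \<Longrightarrow> emeasure \<mu> A \<le> ennreal C * emeasure arclength A"
      by blast
    have "\<exists>f\<in>borel_measurable arclength. \<mu> = density arclength f \<and> (\<forall>x. f x \<le> ennreal (C + 1))"
      using C(2) by (intro bounded_density finite_measure_arclength C(1)) (simp_all add: sets_M)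
    then show ?thesis by blast
  qed
  ultimately show ?thesis by blast
qed

end
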